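(* Let $\mathcal{P}$ be a hereditary property of partitions. Suppose that for every constant $c > 0$ there exists $N = N(c) \in \mathbb{N}$ such that $|\mathcal{P}_N| > c^N$. Then $\mathcal{P}$ contains the partition $H(\pi)$ for every $k \in \mathbb{N}$ and every permutation $\pi$ of $[k]$, and hence $$|\mathcal{P}_n| \ge |\mathcal{P}^{(1,2)}_n| \ge \sum_{k=0}^{\lfloor n/2 \rfloor} \binom{n}{2k} k! = n^{n/2 + o(n)}$$ for every $n \in \mathbb{N}$. This lower bound is best possible, and there is a unique hereditary property of partitions with this speed, i.e. there is exactly one hereditary property $\mathcal{Q}$ of partitions with $|\mathcal{Q}_n| = \sum_{k=0}^{\lfloor n/2 \rfloor} \binom{n}{2k} k!$ for every $n \in \mathbb{N}$.
   Context: A partition of $[n] = \{1,\ldots,n\}$ is an unordered collection of disjoint non-empty sets $\{A_1,\ldots,A_t\}$ with $A_1 \cup \cdots \cup A_t = [n]$. If $P = \{A_1,\ldots,A_t\}$ is a partition of $[n]$ and $S \subset [n]$ has elements $s_1 < \cdots < s_k$, the sub-partition of $P$ induced by $S$ is the partition of $[k]$ obtained from $\{B_1,\ldots,B_t\}$, where $i \in B_j$ if and only if $s_i \in A_j$, by deleting the empty classes. A property of partitions is a collection of partitions of the sets $[n]$; it is hereditary if it is closed under taking induced sub-partitions. $\mathcal{P}_n$ is the set of partitions of $[n]$ in $\mathcal{P}$, and the speed of $\mathcal{P}$ is the function $n \mapsto |\mathcal{P}_n|$. $\mathcal{P}^{(1,2)}$ denotes the set of partitions in $\mathcal{P}$ all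 of whose parts have size at most $2$. For a permutation $\pi$ of $[k]$, $H(\pi)$ is the partition $\{\{i,\pi(i)+k\} : i \in [k]\}$ of $[2k]$. *)

theory Defs
  imports
    Complex_Main
    "HOL-Library.Disjoint_Sets"
    "HOL-Library.Landau_Symbols"
    "HOL-Combinatorics.Permutations"
begin

text \<open>
  A partition of \<open>[n]\<close> is a set \<open>P\<close> of parts with \<open>partition_on {1..n} P\<close>. Since the union of the
  parts is \<open>{1..n}\<close>, the number \<open>n\<close> is determined by \<open>P\<close>, so a collection of partitions of the
  various sets \<open>[n]\<close> can be given the type \<open>nat set set set\<close>. The empty set is the unique
  partition of \<open>[0]\<close>.
\<close>

definition induced_subpartition :: "nat set set \<Rightarrow> nat set \<Rightarrow> nat set set" where
  "induced_subpartition P S =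
     (\<lambda>A. {i \<in> {1..card S}. sorted_list_of_set S ! (i - 1) \<in> A}) ` P - {{}}"

definition partition_property :: "nat set set set \<Rightarrow> bool" where
  "partition_property \<P> \<longleftrightarrow> (\<forall>P\<in>\<P>. \<exists>n. partition_on {1..n} P)"

definition hereditary :: "nat set set set \<Rightarrow> bool" where
  "hereditary \<P> \<longleftrightarrow> partition_property \<P> \<and>
     (\<forall>P\<in>\<P>. \<forall>n S. partition_on {1..n} P \<longrightarrow> S \<subseteq> {1..n} \<longrightarrow> induced_subpartition P S \<in> \<P>)"

definition level :: "nat set set set \<Rightarrow> nat \<Rightarrow> nat set set set" where
  "level \<P> n = {P \<in> \<P>. partition_on {1..n} P}"

definition speed :: "nat set set set \<Rightarrow> nat \<Rightarrow> nat" where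
  "speed \<P> n = card (level \<P> n)"

definition parts_le_2 :: "nat set set set \<Rightarrow> nat set set set" where
  "parts_le_2 \<P> = {P \<in> \<P>. \<forall>A\<in>P. card A \<le> 2}"

definition perm_partition :: "nat \<Rightarrow> (nat \<Rightarrow> nat) \<Rightarrow> nat set set" where
  "perm_partition k \<pi> = {{i, \<pi> i + k} | i. i \<in> {1..k}}"

definition superexponential :: "nat set set set \<Rightarrow> bool" where
  "superexponential \<P> \<longleftrightarrow> (\<forall>c::real. c > 0 \<longrightarrow> (\<exists>N. real (speed \<P> N) > c ^ N))"

definition min_speed :: "nat \<Rightarrow> nat" where
  "min_speed n = (\<Sum>k = 0..n div 2. (n choose (2 * k)) * fact k)"

end

theory Submission
  imports Defs "HOL-Real_Asymp.Real_Asymp"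
begin

text \<open>
  Join consecutive elements of each part by an arc: this encodes a partition of \<open>[n]\<close> as a 0-1 matrix.
  If \<open>\<P>\<close> omits some \<open>H(\<pi>)\<close>, then these matrices all avoid the permutation obtained from \<open>\<pi>\<close> by adding
  a point in the bottom left corner, so by the theorems of Klazar and of Marcus and Tardos there are
  only exponentially many of them. Hence a superexponential hereditary property contains all \<open>H(\<pi>)\<close>,
  and with them all partitions into singletons and pairs whose pairs lie over a common point. These
  form a hereditary property; choosing the \<open>2k\<close> paired elements and the matching of the lower \<open>k\<close> of
  them with the upper \<open>k\<close> counts it exactly, and comparing cardinalities gives uniqueness.
\<close>

subsection \<open>Matrices avoiding a pattern\<close>

text \<open>Recording only consecutive elements of a part is essential. Joining all pairs of a part
  would also determine the partition, but one large part would then contain every pattern while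
  inducing only partitions with at most one part. Superexponentiality promises just one
  \<open>N\<close> for each \<open>c\<close>, so the bound on the number of avoiders has to hold
  with a single base for all \<open>n\<close>. Uniqueness rests on \<open>min_speed\<close> being
  superexponential itself: this puts every crossing partition into any hereditary property with that
  speed.\<close>

text \<open>Only strict inequalities are preserved; for a pattern with at most one point in every row and
  column this is the usual notion of containment.\<close>
definition pattern_in :: "(nat \<times> nat) set \<Rightarrow> (nat \<times> nat) set \<Rightarrow> bool" where
  "pattern_in F M \<longleftrightarrow> (\<exists>\<phi>. \<phi> ` F \<subseteq> M \<and>
     (\<forall>p\<in>F. \<forall>p'\<in>F. (fst p < fst p' \<longrightarrow> fst (\<phi> p) < fst (\<phi> p')) \<and>
                     (snd p < snd p' \<longrightarrow> snd (\<phi> p) < snd (\<phi> p'))))"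

text \<open>Transposition turns the count of wide blocks into the count of tall ones, so only one of
  the two has to be proved.\<close>

lemma pattern_in_converse: "pattern_in (F\<inverse>) (M\<inverse>) \<longleftrightarrow> pattern_in F M"
proof -
  have *: "pattern_in (F\<inverse>) (M\<inverse>)" if "pattern_in F M" for F M
  proof -
    from that obtain \<phi> where \<phi>: "\<phi> ` F \<subseteq> M"
      "\<And>p p'. p \<in> F \<Longrightarrow> p' \<in> F \<Longrightarrow> fst p < fst p' \<Longrightarrow> fst (\<phi> p) < fst (\<phi> p')"
      "\<And>p p'. p \<in> F \<Longrightarrow> p' \<in> F \<Longrightarrow> snd p < snd p' \<Longrightarrow> snd (\<phi> p) < snd (\<phi> p')"
      unfolding pattern_in_def by blast
    have "prod.swap (\<phi> (prod.swap p)) \<in> M\<inverse>" if "p \<in> F\<inverse>" for p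
    proof -
      have "prod.swap p \<in> F" using that by (cases p) auto
      then have "\<phi> (prod.swap p) \<in> M" using \<phi>(1) by blast
      then show ?thesis by (cases "\<phi> (prod.swap p)") auto
    qed
    with \<phi>(2,3) show ?thesis
      unfolding pattern_in_def
      by (intro exI[of _ "\<lambda>p. prod.swap (\<phi> (prod.swap p))"] conjI image_subsetI) auto
  qed
  from *[of F M] *[of "F\<inverse>" "M\<inverse>"] show ?thesis by auto
qed

section \<open>Contraction and wide blocks\<close>

definition contract :: "nat \<Rightarrow> nat \<times> nat \<Rightarrow> nat \<times> nat" where
  "contract q p = (fst p div q, snd p div q)"

lemma less_if_div_less: "a div q < b div q \<Longrightarrow> a < b" for a b q :: nat
  by (meson div_le_mono leD leI)

text \<open>Strictly ordered block indices force strictly ordered coordinates, so any choice of one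
  entry of \<open>M\<close> per block lifts the occurrence. Coordinates that agree in
  \<open>F\<close> need not agree after the lift, which is why \<open>pattern_in\<close> asks for
  strict inequalities only.\<close>

lemma pattern_in_contract: "pattern_in F (contract q ` M) \<Longrightarrow> pattern_in F M"
proof -
  assume "pattern_in F (contract q ` M)"
  then obtain \<phi> where \<phi>: "\<phi> ` F \<subseteq> contract q ` M"
      "\<And>p p'. p \<in> F \<Longrightarrow> p' \<in> F \<Longrightarrow> fst p < fst p' \<Longrightarrow> fst (\<phi> p) < fst (\<phi> p')"
      "\<And>p p'. p \<in> F \<Longrightarrow> p' \<in> F \<Longrightarrow> snd p < snd p' \<Longrightarrow> snd (\<phi> p) < snd (\<phi> p')"
      unfolding pattern_in_def by blast
  then have "\<forall>p\<in>F. \<exists>z\<in>M. \<phi> p = contract q z" by blast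
  then obtain \<psi> where \<psi>: "\<And>p. p \<in> F \<Longrightarrow> \<psi> p \<in> M \<and> \<phi> p = contract q (\<psi> p)" by metis
  show ?thesis unfolding pattern_in_def
  proof (intro exI[of _ \<psi>] conjI ballI impI)
    fix p p' assume "p \<in> F" "p' \<in> F" "fst p < fst p'"
    then show "fst (\<psi> p) < fst (\<psi> p')"
      using \<phi>(2)[of p p'] \<psi>[of p] \<psi>[of p'] less_if_div_less[of "fst (\<psi> p)" q] 
      by (simp add: contract_def)
  next
    fix p p' assume "p \<in> F" "p' \<in> F" "snd p < snd p'"
    then show "snd (\<psi> p) < snd (\<psi> p')"
      using \<phi>(3)[of p p'] \<psi>[of p] \<psi>[of p'] less_if_div_less[of "snd (\<psi> p)" q] 
      by (simp add: contract_def)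
  qed (use \<psi> in auto)
qed

lemma strict_mono_enum_into:
  fixes I :: "nat set"
  assumes "finite I" "k \<le> card I"
  obtains e where "\<And>i. i < k \<Longrightarrow> e i \<in> I" "\<And>i j. i < j \<Longrightarrow> j < k \<Longrightarrow> e i < e j"
proof
  let ?e = "\<lambda>i. sorted_list_of_set I ! i"
  show "?e i \<in> I" if "i < k" for i
    using that assms by (metis less_le_trans nth_mem set_sorted_list_of_set sorted_list_of_set.length_sorted_key_list_of_set)
  show "?e i < ?e j" if "i < j" "j < k" for i j
    using that assms by (simp add: sorted_wrt_nth_less[OF strict_sorted_list_of_set])
qed

text \<open>Columns are counted relative to the block. The occupied rows of a block are obtained as
  \<open>block_cols\<close> of the transposed matrix.\<close>

definition block_cols :: "nat \<Rightarrow> (nat \<times> nat) set \<Rightarrow> nat \<times> nat \<Rightarrow> nat set" where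
  "block_cols q M b = {snd z mod q | z. z \<in> M \<and> contract q z = b}"

lemma block_cols_subset: "q > 0 \<Longrightarrow> block_cols q M b \<subseteq> {..<q}"
  by (auto simp: block_cols_def)

text \<open>A point \<open>(a, b)\<close> of \<open>F\<close> goes to the \<open>a\<close>-th block
  and there to the \<open>b\<close>-th common column. Rows are ordered because the blocks lie in
  different block rows, columns because the residues are ordered inside the single block column
  \<open>j\<close>.\<close>

lemma pattern_in_common_cols:
  assumes "F \<subseteq> {..<k} \<times> {..<k}" "finite I" "k \<le> card I" "finite C" "k \<le> card C"
    and cols: "\<And>i. i \<in> I \<Longrightarrow> C \<subseteq> block_cols q M (i, j)"
  shows "pattern_in F M"
proof -
  obtain e where e: "\<And>i. i < k \<Longrightarrow> e i \<in> I" "\<And>i j. i < j \<Longrightarrow> j < k \<Longrightarrow> e i < e j"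
    using strict_mono_enum_into[of I k] assms by blast
  obtain d where d: "\<And>i. i < k \<Longrightarrow> d i \<in> C" "\<And>i j. i < j \<Longrightarrow> j < k \<Longrightarrow> d i < d j"
    using strict_mono_enum_into[of C k] assms by blast
  have "\<exists>z\<in>M. contract q z = (e (fst p), j) \<and> snd z mod q = d (snd p)" if "p \<in> F" for p
  proof -
    have "fst p < k" "snd p < k" using that assms(1) by auto
    then have "d (snd p) \<in> block_cols q M (e (fst p), j)" using cols e d by blast
    then show ?thesis unfolding block_cols_def by auto
  qed
  then obtain \<phi> where \<phi>: "\<And>p. p \<in> F \<Longrightarrow> \<phi> p \<in> M"
    "\<And>p. p \<in> F \<Longrightarrow> contract q (\<phi> p) = (e (fst p), j)"
    "\<And>p. p \<in> F \<Longrightarrow> snd (\<phi> p) mod q = d (snd p)" by metis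
  show ?thesis unfolding pattern_in_def
  proof (intro exI[of _ \<phi>] conjI ballI impI)
    fix p p' assume p: "p \<in> F" "p' \<in> F" "fst p < fst p'"
    then have "fst p' < k" using assms(1) by auto
    with p show "fst (\<phi> p) < fst (\<phi> p')"
      using \<phi>(2)[of p] \<phi>(2)[of p'] e(2)[of "fst p" "fst p'"]
      by - (rule less_if_div_less[of _ q], simp add: contract_def)
  next
    fix p p' assume p: "p \<in> F" "p' \<in> F" "snd p < snd p'"
    then have "snd p' < k" using assms(1) by auto
    with p have "snd (\<phi> p) mod q < snd (\<phi> p') mod q" by (simp add: \<phi>(3) d(2))
    moreover have "snd (\<phi> p) div q = snd (\<phi> p') div q"
      using \<phi>(2)[of p] \<phi>(2)[of p'] p by (simp add: contract_def)
    ultimately show "snd (\<phi> p) < snd (\<phi> p')"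
      by (metis div_mult_mod_eq nat_add_left_cancel_less)
  qed (use \<phi> in auto)
qed

text \<open>Pigeonhole on the column sets of the blocks in one block column.\<close>
lemma card_wide_blocks_le:
  assumes F: "F \<subseteq> {..<k} \<times> {..<k}" "\<not> pattern_in F M" and "q > 0"
    and B: "B \<subseteq> {..<n} \<times> {..<n}"
  shows "card {b \<in> B. k \<le> card (block_cols q M b)} \<le> n * (2 ^ q * k)"
proof -
  let ?W = "\<lambda>j K. {i \<in> {..<n}. block_cols q M (i, j) = K \<and> k \<le> card K}"
  note sub = block_cols_subset[OF \<open>q > 0\<close>, of M]
  \<comment> \<open>The bound \<open>k\<close> rather than \<open>k - 1\<close> makes the offending
    set nonempty even for \<open>k = 0\<close>; an element of it shows that \<open>K\<close> is
    finite.\<close>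
  have W: "card (?W j K) \<le> k" for j K
  proof (rule ccontr)
    assume "\<not> card (?W j K) \<le> k"
    then have k: "k \<le> card (?W j K)" and "?W j K \<noteq> {}" by (simp, metis card.empty zero_le)
    then obtain i where "i \<in> ?W j K" by blast
    then have "finite K" "k \<le> card K" using sub[of "(i,j)"] finite_subset by auto
    then have "pattern_in F M"
      by (intro pattern_in_common_cols[OF F(1), of "?W j K" K q M j] k) auto
    with F(2) show False by simp
  qed
  \<comment> \<open>Wide blocks are sorted by block column and by their full column set, which
    leaves \<open>2 ^ q\<close> classes per block column.\<close>
  have "{b \<in> B. k \<le> card (block_cols q M b)} \<subseteq> (\<Union>j\<in>{..<n}. \<Union>K\<in>Pow {..<q}. (\<lambda>i. (i,j)) ` ?W j K)"
  proof
    fix b assume b: "b \<in> {b \<in> B. k \<le> card (block_cols q M b)}"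
    obtain i j where ij: "b = (i, j)" by fastforce
    with b B have "j \<in> {..<n}" "i \<in> ?W j (block_cols q M b)" by auto
    with sub[of b] ij show "b \<in> (\<Union>j\<in>{..<n}. \<Union>K\<in>Pow {..<q}. (\<lambda>i. (i,j)) ` ?W j K)" by blast
  qed
  then have "card {b \<in> B. k \<le> card (block_cols q M b)} \<le>
      card (\<Union>j\<in>{..<n}. \<Union>K\<in>Pow {..<q}. (\<lambda>i. (i,j)) ` ?W j K)"
    by (intro card_mono) auto
  also have "\<dots> \<le> (\<Sum>j<n. card (\<Union>K\<in>Pow {..<q}. (\<lambda>i. (i,j)) ` ?W j K))"
    by (intro card_UN_le) auto
  also have "\<dots> \<le> (\<Sum>j<n. \<Sum>K\<in>Pow {..<q}. card ((\<lambda>i. (i,j)) ` ?W j K))"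
    by (intro sum_mono card_UN_le) auto
  also have "\<dots> \<le> (\<Sum>j<n. \<Sum>K\<in>Pow {..<q}. k)"
    by (intro sum_mono order.trans[OF card_image_le W]) auto
  also have "\<dots> = n * (2 ^ q * k)" by (simp add: card_Pow)
  finally show ?thesis .
qed

lemma contract_converse: "contract q (prod.swap z) = prod.swap (contract q z)"
  by (simp add: contract_def)

text \<open>Reduced modulo \<open>q\<close>, the entries of a block embed into the product of its
  occupied rows and its occupied columns. A block that is neither wide nor tall therefore has at
  most \<open>k\<^sup>2\<close> entries.\<close>

lemma card_block_le:
  assumes "q > 0"
  shows "card {z \<in> M. contract q z = b} \<le> card (block_cols q (M\<inverse>) (prod.swap b)) * card (block_cols q M b)"
proof -
  let ?f = "\<lambda>z. (fst z mod q, snd z mod q)"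
  have fin: "finite (block_cols q M b)" for M b
    using finite_subset[OF block_cols_subset[OF assms]] by blast
  have "inj_on ?f {z \<in> M. contract q z = b}"
  proof (rule inj_onI)
    fix z z' assume "z \<in> {z \<in> M. contract q z = b}" "z' \<in> {z \<in> M. contract q z = b}" "?f z = ?f z'"
    then have "fst z div q = fst z' div q" "snd z div q = snd z' div q"
      "fst z mod q = fst z' mod q" "snd z mod q = snd z' mod q" by (auto simp: contract_def)
    then show "z = z'" by (metis div_mult_mod_eq prod_eqI)
  qed
  then have "card {z \<in> M. contract q z = b} = card (?f ` {z \<in> M. contract q z = b})"
    by (simp add: card_image)
  also have "\<dots> \<le> card (block_cols q (M\<inverse>) (prod.swap b) \<times> block_cols q M b)"
  proof (intro card_mono subsetI)
    fix w assume "w \<in> ?f ` {z \<in> M. contract q z = b}"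
    then obtain z where z: "z \<in> M" "contract q z = b" "w = ?f z" by auto
    then have "prod.swap z \<in> M\<inverse>" by (cases z) auto
    with z have "fst z mod q \<in> block_cols q (M\<inverse>) (prod.swap b)"
      unfolding block_cols_def
      by (intro CollectI exI[of _ "prod.swap z"]) (simp add: contract_converse)
    moreover have "snd z mod q \<in> block_cols q M b"
      unfolding block_cols_def using z by blast
    ultimately show "w \<in> block_cols q (M\<inverse>) (prod.swap b) \<times> block_cols q M b"
      using z by simp
  qed (auto simp: fin)
  also have "\<dots> = card (block_cols q (M\<inverse>) (prod.swap b)) * card (block_cols q M b)"
    by (rule card_cartesian_product)
  finally show ?thesis .
qed

text \<open>The wide blocks \<open>W\<close> and the tall blocks \<open>U\<close> may be full, but
  their number is linear in \<open>n\<close>; every other nonempty block contributes at most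
  \<open>k\<^sup>2\<close>.\<close>

lemma card_avoiding_contract:
  assumes F: "F \<subseteq> {..<k} \<times> {..<k}" "\<not> pattern_in F M" and q: "q > 0"
    and M: "M \<subseteq> {..<q * n} \<times> {..<q * n}"
  shows "card M \<le> 2 * (n * (2 ^ q * k)) * q\<^sup>2 + k\<^sup>2 * card (contract q ` M)"
proof -
  let ?B = "contract q ` M"
  have finM: "finite M" using M finite_subset by blast
  have B: "?B \<subseteq> {..<n} \<times> {..<n}"
    using M q by (auto simp: contract_def less_mult_imp_div_less mult.commute)
  define W where "W = {b \<in> ?B. k \<le> card (block_cols q M b)}"
  define U where "U = {b \<in> ?B. k \<le> card (block_cols q (M\<inverse>) (prod.swap b))}"
  have W: "card W \<le> n * (2 ^ q * k)"
    unfolding W_def by (rule card_wide_blocks_le[OF F q B])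
  \<comment> \<open>Tall blocks are the wide blocks of the transpose, which avoids the transposed
    pattern.\<close>
  have "U \<subseteq> prod.swap ` {b \<in> ?B\<inverse>. k \<le> card (block_cols q (M\<inverse>) b)}"
  proof
    fix b assume "b \<in> U"
    then show "b \<in> prod.swap ` {b \<in> ?B\<inverse>. k \<le> card (block_cols q (M\<inverse>) b)}"
      unfolding U_def by (cases b) (auto intro!: image_eqI[of _ _ "prod.swap b"])
  qed
  then have "card U \<le> card {b \<in> ?B\<inverse>. k \<le> card (block_cols q (M\<inverse>) b)}"
    using finM by (intro surj_card_le) auto
  also have "\<dots> \<le> n * (2 ^ q * k)"
    using F B by (intro card_wide_blocks_le[of "F\<inverse>"] q) (auto simp: pattern_in_converse)
  finally have U: "card U \<le> n * (2 ^ q * k)" .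
  have fin: "finite ?B" "finite W" "finite U" using finM by (auto simp: W_def U_def)
  have le_q: "card (block_cols q M b) \<le> q" for M b
    using card_mono[OF _ block_cols_subset[OF q]] by simp
  have "card M = card (\<Union>b\<in>?B. {z \<in> M. contract q z = b})"
    by (rule arg_cong[of _ _ card]) auto
  also have "\<dots> \<le> (\<Sum>b\<in>?B. card {z \<in> M. contract q z = b})"
    by (rule card_UN_le[OF fin(1)])
  also have "\<dots> \<le> (\<Sum>b\<in>?B. (if b \<in> W then q\<^sup>2 else 0) + (if b \<in> U then q\<^sup>2 else 0) + k\<^sup>2)"
  proof (rule sum_mono)
    fix b assume b: "b \<in> ?B"
    have "card {z \<in> M. contract q z = b} \<le> card (block_cols q (M\<inverse>) (prod.swap b)) * card (block_cols q M b)"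
      by (rule card_block_le[OF q])
    moreover have "card (block_cols q (M\<inverse>) (prod.swap b)) * card (block_cols q M b) \<le> q\<^sup>2" using le_q by (simp add: power2_eq_square mult_le_mono)
    moreover have "card (block_cols q (M\<inverse>) (prod.swap b)) * card (block_cols q M b) \<le> k\<^sup>2" if "b \<notin> W" "b \<notin> U"
      using that b by (simp add: W_def U_def power2_eq_square mult_le_mono)
    ultimately show "card {z \<in> M. contract q z = b} \<le>
       (if b \<in> W then q\<^sup>2 else 0) + (if b \<in> U then q\<^sup>2 else 0) + k\<^sup>2" by auto
  qed
  also have "\<dots> = card W * q\<^sup>2 + card U * q\<^sup>2 + card ?B * k\<^sup>2"
  proof -
    have "?B \<inter> W = W" "?B \<inter> U = U" by (auto simp: W_def U_def)
    then show ?thesis using fin by (simp add: sum.distrib sum.If_cases)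
  qed
  also have "\<dots> \<le> 2 * (n * (2 ^ q * k)) * q\<^sup>2 + k\<^sup>2 * card ?B"
    using add_mono[OF mult_le_mono1[OF W, of "q\<^sup>2"] mult_le_mono1[OF U, of "q\<^sup>2"]] by simp
  finally show ?thesis .
qed

text \<open>Marcus and Tardos: contraction by \<open>q > k\<^sup>2\<close> loses at most a factor \<open>k\<^sup>2\<close>, up to the linear
  contribution of the wide and tall blocks.\<close>
lemma card_avoiding_le:
  assumes F: "F \<subseteq> {..<k} \<times> {..<k}" and q: "q = k\<^sup>2 + 2"
  shows "M \<subseteq> {..<q ^ m} \<times> {..<q ^ m} \<Longrightarrow> \<not> pattern_in F M \<Longrightarrow> card M \<le> (k * 2 ^ q * q\<^sup>2 + 1) * q ^ m"
proof (induction m arbitrary: M)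
  case 0
  then have "card M \<le> card ({..<1::nat} \<times> {..<1::nat})" by (intro card_mono) auto
  then show ?case by simp
next
  case (Suc m)
  let ?c = "k * 2 ^ q * q\<^sup>2 + 1"
  have q0: "q > 0" using q by simp
  have "contract q ` M \<subseteq> {..<q ^ m} \<times> {..<q ^ m}"
    using Suc.prems(1) q0 by (auto simp: contract_def less_mult_imp_div_less mult.commute)
  then have IH: "card (contract q ` M) \<le> ?c * q ^ m"
    using Suc.IH pattern_in_contract Suc.prems(2) by blast
  have "card M \<le> 2 * (q ^ m * (2 ^ q * k)) * q\<^sup>2 + k\<^sup>2 * card (contract q ` M)"
    using card_avoiding_contract[OF F Suc.prems(2) q0, of "q ^ m"] Suc.prems(1) by simp
  also have "\<dots> \<le> 2 * (q ^ m * (2 ^ q * k)) * q\<^sup>2 + k\<^sup>2 * (?c * q ^ m)"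
    using IH by (intro add_left_mono mult_left_mono) auto
  \<comment> \<open>The linear term costs \<open>2 * ?c * q ^ m\<close> and the contraction
    \<open>k\<^sup>2 * ?c * q ^ m\<close>; the choice \<open>q = k\<^sup>2 + 2\<close> makes the sum
    exactly \<open>?c * q ^ Suc m\<close>. The \<open>+ 1\<close> in \<open>?c\<close> pays for the
    single cell at \<open>m = 0\<close>.\<close>
  also have "\<dots> \<le> 2 * ?c * q ^ m + k\<^sup>2 * (?c * q ^ m)"
    by (simp only: algebra_simps)
  also have "\<dots> = ?c * q ^ m * (k\<^sup>2 + 2)" by (simp add: algebra_simps)
  also have "\<dots> = ?c * q ^ Suc m" by (subst q[symmetric]) (simp only: power_Suc mult_ac)
  finally show ?case .
qed

text \<open>Klazar's reduction of the enumeration of pattern-avoiding matrices to the bound on their weight: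
  a matrix is determined by its contraction and by the contents of the nonempty blocks.\<close>
lemma card_avoiders_le:
  assumes F: "F \<subseteq> {..<k} \<times> {..<k}" and q: "q = k\<^sup>2 + 2"
  shows "card {M. M \<subseteq> {..<q ^ m} \<times> {..<q ^ m} \<and> \<not> pattern_in F M} \<le> 2 ^ (q\<^sup>2 * (k * 2 ^ q * q\<^sup>2 + 1) * q ^ m)"
proof (induction m)
  case 0
  have "card {M. M \<subseteq> {..<q ^ 0} \<times> {..<q ^ 0} \<and> \<not> pattern_in F M} \<le> card (Pow ({..<1::nat} \<times> {..<1::nat}))"
    by (intro card_mono) auto
  also have "\<dots> = 2 ^ 1" by (simp add: card_Pow)
  also have "\<dots> \<le> 2 ^ (q\<^sup>2 * (k * 2 ^ q * q\<^sup>2 + 1) * q ^ 0)"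
    using q by (intro power_increasing) (simp_all add: Suc_le_eq)
  finally show ?case .
next
  case (Suc m)
  let ?c = "k * 2 ^ q * q\<^sup>2 + 1"
  let ?T = "\<lambda>m. {M. M \<subseteq> {..<q ^ m} \<times> {..<q ^ m} \<and> \<not> pattern_in F M}"
  have q0: "q > 0" and q2: "2 \<le> q" using q by simp_all
  have finT: "finite (?T m)" for m by (rule finite_subset[of _ "Pow ({..<q ^ m} \<times> {..<q ^ m})"]) auto
  \<comment> \<open>All cells of the blocks indexed by \<open>B\<close>: every matrix with
    contraction \<open>B\<close> is a subset of \<open>X B\<close>.\<close>
  define X where "X = (\<lambda>B. {z. contract q z \<in> B})"
  have cardX: "finite (X B) \<and> card (X B) \<le> q\<^sup>2 * card B" if "finite B" for B
  proof -
    have eq: "X B \<subseteq> (\<lambda>(b, r). (fst b * q + fst r, snd b * q + snd r)) ` (B \<times> ({..<q} \<times> {..<q}))"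
    proof
      fix z assume "z \<in> X B"
      then have "contract q z \<in> B" by (simp add: X_def)
      then show "z \<in> (\<lambda>(b, r). (fst b * q + fst r, snd b * q + snd r)) ` (B \<times> ({..<q} \<times> {..<q}))"
        using q0 by (intro image_eqI[of _ _ "(contract q z, (fst z mod q, snd z mod q))"])
          (auto simp: contract_def)
    qed
    have "card ((\<lambda>(b, r). (fst b * q + fst r, snd b * q + snd r)) ` (B \<times> ({..<q} \<times> {..<q}))) \<le> card (B \<times> ({..<q} \<times> {..<q}))"
      using that by (intro card_image_le) auto
    also have "\<dots> = q\<^sup>2 * card B" by (simp add: card_cartesian_product power2_eq_square)
    finally show ?thesis
      using le_trans[OF card_mono[OF _ eq]] finite_subset[OF eq] that by auto
  qed
  have "?T (Suc m) \<subseteq> (\<Union>B\<in>?T m. Pow (X B))"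
  proof
    fix M assume M: "M \<in> ?T (Suc m)"
    then have "contract q ` M \<subseteq> {..<q ^ m} \<times> {..<q ^ m}"
      using q0 by (auto simp: contract_def less_mult_imp_div_less mult.commute)
    then have "contract q ` M \<in> ?T m" using pattern_in_contract M by blast
    moreover have "M \<subseteq> X (contract q ` M)" by (auto simp: X_def)
    ultimately show "M \<in> (\<Union>B\<in>?T m. Pow (X B))" by blast
  qed
  have finB: "finite B" if "B \<in> ?T m" for B
    using that finite_subset[of B "{..<q ^ m} \<times> {..<q ^ m}"] by auto
  have "card (?T (Suc m)) \<le> card (\<Union>B\<in>?T m. Pow (X B))"
    using \<open>?T (Suc m) \<subseteq> _\<close> finT cardX finB by (intro card_mono finite_UN_I) auto
  also have "\<dots> \<le> (\<Sum>B\<in>?T m. card (Pow (X B)))"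
    by (rule card_UN_le[OF finT])
  also have "\<dots> \<le> (\<Sum>B\<in>?T m. 2 ^ (q\<^sup>2 * ?c * q ^ m))"
  proof (rule sum_mono)
    fix B assume B: "B \<in> ?T m"
    have "card (X B) \<le> q\<^sup>2 * card B" using cardX finB[OF B] by blast
    also have "\<dots> \<le> q\<^sup>2 * (?c * q ^ m)"
      using card_avoiding_le[OF F q, of B m] B by (intro mult_left_mono) auto
    finally show "card (Pow (X B)) \<le> 2 ^ (q\<^sup>2 * ?c * q ^ m)"
      using cardX finB[OF B] by (simp only: card_Pow mult.assoc) (simp add: power_increasing)
  qed
  also have "\<dots> = card (?T m) * 2 ^ (q\<^sup>2 * ?c * q ^ m)" by simp
  \<comment> \<open>Both factors have the same exponent, linear in the side length
    \<open>q ^ m\<close>, because the contraction has only linearly many entries. The doubling is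
    absorbed by the next factor \<open>q \<ge> 2\<close>.\<close>
  also have "\<dots> \<le> 2 ^ (q\<^sup>2 * ?c * q ^ m) * 2 ^ (q\<^sup>2 * ?c * q ^ m)"
    using Suc.IH by (intro mult_right_mono) auto
  also have "\<dots> = 2 ^ (q\<^sup>2 * ?c * q ^ m * 2)" by (simp flip: power_add)
  also have "\<dots> \<le> 2 ^ (q\<^sup>2 * ?c * q ^ m * q)"
    using q2 by (intro power_increasing mult_left_mono) auto
  also have "\<dots> = 2 ^ (q\<^sup>2 * ?c * q ^ Suc m)" by (simp add: mult_ac)
  finally show ?case .
qed

subsection \<open>Arcs of a partition\<close>

text \<open>A strictly increasing \<open>f\<close> is the enumeration of its own image, so the
  induced classes are preimages under \<open>f\<close>.\<close>

lemma induced_subpartition_image: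
  assumes f: "strict_mono_on {1..m} f"
  shows "induced_subpartition P (f ` {1..m}) = (\<lambda>A. {i \<in> {1..m}. f i \<in> A}) ` P - {{}}"
proof -
  have card: "card (f ` {1..m}) = m"
    using strict_mono_on_imp_inj_on[OF f] by (simp add: card_image)
  have "sorted_wrt (<) (map f [1..<Suc m])"
    unfolding sorted_wrt_map
    by (rule sorted_wrt_mono_rel[OF _ sorted_wrt_upt]) (use f in \<open>auto simp: strict_mono_on_def\<close>)
  moreover have "set (map f [1..<Suc m]) = f ` {1..m}"
    by (simp add: atLeastLessThanSuc_atLeastAtMost del: upt_Suc)
  ultimately have "sorted_list_of_set (f ` {1..m}) = map f [1..<Suc m]"
    by (intro strict_sorted_equal) auto
  then have "sorted_list_of_set (f ` {1..m}) ! (i - 1) = f i" if "i \<in> {1..m}" for i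
    using that by (auto simp: nth_map_upt simp del: upt_Suc)
  then have "{i \<in> {1..m}. sorted_list_of_set (f ` {1..m}) ! (i - 1) \<in> A} = {i \<in> {1..m}. f i \<in> A}" for A
    by auto
  then show ?thesis unfolding induced_subpartition_def card by simp
qed

text \<open>Indexed from 1.\<close>
definition enum :: "nat set \<Rightarrow> nat \<Rightarrow> nat" where
  "enum S i = sorted_list_of_set S ! (i - 1)"

lemma strict_mono_on_enum: "finite S \<Longrightarrow> strict_mono_on {1..card S} (enum S)"
  unfolding enum_def
  by (intro strict_mono_onI sorted_wrt_nth_less[OF strict_sorted_list_of_set]) auto

lemma enum_image:
  assumes "finite S"
  shows "enum S ` {1..card S} = S"
proof -
  have "enum S ` {1..card S} = (!) (sorted_list_of_set S) ` {..<length (sorted_list_of_set S)}"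
  proof -
    have "(\<lambda>i. i - 1) ` {1..card S} = {..<card S}"
      by (auto intro!: image_eqI[of _ _ "Suc _"])
    then show ?thesis by (simp add: enum_def image_image[symmetric, of _ "\<lambda>i. i - 1"] del: One_nat_def)
  qed
  also have "\<dots> = S" using assms by (simp add: lessThan_atLeast0 nth_image del: length_sorted_list_of_set sorted_list_of_set.length_sorted_key_list_of_set)
  finally show ?thesis .
qed

lemma partition_on_same_part:
  "partition_on X P \<Longrightarrow> A \<in> P \<Longrightarrow> B \<in> P \<Longrightarrow> x \<in> A \<Longrightarrow> x \<in> B \<Longrightarrow> A = B"
  by (auto simp: partition_on_def disjoint_def)

definition arcs :: "nat set set \<Rightarrow> (nat \<times> nat) set" where
  "arcs P = {(x, y). x < y \<and> (\<exists>A\<in>P. x \<in> A \<and> y \<in> A \<and> (\<forall>z\<in>A. z \<le> x \<or> y \<le> z))}"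

text \<open>Descend from \<open>y\<close> to its predecessor \<open>w\<close> in \<open>A\<close>.
  As long as \<open>x < y\<close>, the point \<open>x\<close> is itself a candidate, so the descent
  never passes below \<open>x\<close>.\<close>

lemma arcs_rtrancl_if_same_part:
  assumes A: "A \<in> P" "x \<in> A"
  shows "y \<in> A \<Longrightarrow> x \<le> y \<Longrightarrow> (x, y) \<in> (arcs P)\<^sup>*"
proof (induction y rule: less_induct)
  case (less y)
  show ?case
  proof (cases "x = y")
    case False
    let ?Z = "{z \<in> A. z < y}"
    have Z: "finite ?Z" "x \<in> ?Z" using False less.prems A by auto
    define w where "w = Max ?Z"
    have w: "w \<in> ?Z" unfolding w_def using Z by (intro Max_in) auto
    have wmax: "z \<le> w" if "z \<in> ?Z" for z unfolding w_def using Z that by simp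
    have "z \<le> w \<or> y \<le> z" if "z \<in> A" for z using wmax[of z] that by auto
    then have "(w, y) \<in> arcs P" using w A less.prems by (auto simp: arcs_def)
    moreover have "(x, w) \<in> (arcs P)\<^sup>*" using less.IH[of w] w wmax[OF Z(2)] by auto
    ultimately show ?thesis by auto
  qed simp
qed

lemma same_part_if_arcs_rtrancl:
  assumes P: "partition_on X P" and x: "x \<in> X"
  shows "(x, y) \<in> (arcs P)\<^sup>* \<Longrightarrow> \<exists>A\<in>P. x \<in> A \<and> y \<in> A"
proof (induction rule: rtrancl_induct)
  case base
  then show ?case using P x by (auto simp: partition_on_def)
next
  case (step y z)
  then obtain A B where "A \<in> P" "x \<in> A" "y \<in> A" "B \<in> P" "y \<in> B" "z \<in> B"
    by (auto simp: arcs_def)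
  then show ?case using partition_on_same_part[OF P] by blast
qed

text \<open>Arcs only go upwards, hence the two directions; the restriction to \<open>X\<close> cuts
  off the reflexive pairs outside. The right side mentions \<open>P\<close> only through its arcs,
  which gives injectivity of the encoding.\<close>

lemma same_part_eq_arcs:
  assumes P: "partition_on X P"
  shows "{(x, y). \<exists>A\<in>P. x \<in> A \<and> y \<in> A} =
         {(x, y) \<in> X \<times> X. (x, y) \<in> (arcs P)\<^sup>* \<or> (y, x) \<in> (arcs P)\<^sup>*}"
proof -
  have "x \<in> X" if "A \<in> P" "x \<in> A" for x A using P that by (auto simp: partition_on_def)
  moreover have "(x, y) \<in> (arcs P)\<^sup>* \<or> (y, x) \<in> (arcs P)\<^sup>*" if "A \<in> P" "x \<in> A" "y \<in> A" for A x y
    using that arcs_rtrancl_if_same_part[of A P] nat_le_linear[of x y] by blast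
  moreover have "\<exists>A\<in>P. x \<in> A \<and> y \<in> A" if "x \<in> X" "y \<in> X" "(x, y) \<in> (arcs P)\<^sup>* \<or> (y, x) \<in> (arcs P)\<^sup>*" for x y
    using that same_part_if_arcs_rtrancl[OF P] by blast
  ultimately have "(\<exists>A\<in>P. x \<in> A \<and> y \<in> A) \<longleftrightarrow> x \<in> X \<and> y \<in> X \<and> ((x, y) \<in> (arcs P)\<^sup>* \<or> (y, x) \<in> (arcs P)\<^sup>*)" for x y
    by (metis (lifting))
  then show ?thesis by simp
qed

lemma arcs_inject:
  assumes "partition_on X P" "partition_on X P'" "arcs P = arcs P'"
  shows "P = P'"
proof -
  have "P = X // {(x, y). \<exists>A\<in>P. x \<in> A \<and> y \<in> A}"
    using partition_on_eq_quotient[OF assms(1)] by (rule sym)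
  also have "\<dots> = X // {(x, y). \<exists>A\<in>P'. x \<in> A \<and> y \<in> A}"
    unfolding same_part_eq_arcs[OF assms(1)] same_part_eq_arcs[OF assms(2)] assms(3) ..
  also have "\<dots> = P'" by (rule partition_on_eq_quotient[OF assms(2)])
  finally show ?thesis .
qed

text \<open>The extra point in the bottom left corner forces all left endpoints of an occurrence of
  \<open>\<pi>\<close> among the arcs to precede all right endpoints; arcs over a common point lie in distinct parts.\<close>
definition corner_pattern :: "nat \<Rightarrow> (nat \<Rightarrow> nat) \<Rightarrow> (nat \<times> nat) set" where
  "corner_pattern k \<pi> = insert (k + 1, 1) ((\<lambda>i. (i, \<pi> i + 1)) ` {1..k})"

text \<open>The \<open>2 * k\<close> endpoints of the arcs that realise \<open>\<pi>\<close> induce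
  \<open>H(\<pi>)\<close>; the arc from the corner only separates left endpoints from right
  ones.\<close>

lemma perm_partition_if_pattern_in_arcs:
  assumes her: "hereditary \<P>" and P: "P \<in> \<P>" "partition_on {1..n} P"
    and \<pi>: "\<pi> permutes {1..k}" and pat: "pattern_in (corner_pattern k \<pi>) (arcs P)"
  shows "perm_partition k \<pi> \<in> \<P>"
proof -
  obtain \<phi> where \<phi>: "\<phi> ` corner_pattern k \<pi> \<subseteq> arcs P"
      "\<And>p p'. p \<in> corner_pattern k \<pi> \<Longrightarrow> p' \<in> corner_pattern k \<pi> \<Longrightarrow> fst p < fst p' \<Longrightarrow> fst (\<phi> p) < fst (\<phi> p')"
      "\<And>p p'. p \<in> corner_pattern k \<pi> \<Longrightarrow> p' \<in> corner_pattern k \<pi> \<Longrightarrow> snd p < snd p' \<Longrightarrow> snd (\<phi> p) < snd (\<phi> p')"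
    using pat unfolding pattern_in_def by blast
  define x where "x i = fst (\<phi> (i, \<pi> i + 1))" for i
  define y where "y i = snd (\<phi> (i, \<pi> i + 1))" for i
  define u where "u = fst (\<phi> (k + 1, 1))"
  define v where "v = snd (\<phi> (k + 1, 1))"
  have mem: "(i, \<pi> i + 1) \<in> corner_pattern k \<pi>" if "i \<in> {1..k}" for i
    using that by (auto simp: corner_pattern_def)
  have memc: "(k + 1, 1) \<in> corner_pattern k \<pi>" by (simp add: corner_pattern_def)
  have \<pi>in: "\<pi> i \<in> {1..k}" if "i \<in> {1..k}" for i
    using that permutes_in_image[OF \<pi>] by blast
  have arc: "(x i, y i) \<in> arcs P" if "i \<in> {1..k}" for i
    using \<phi>(1) mem[OF that] unfolding x_def y_def by auto
  have "(u, v) \<in> arcs P"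
    using \<phi>(1) memc unfolding u_def v_def by auto
  then have uv: "u < v" by (auto simp: arcs_def)
  have xu: "x i < u" if "i \<in> {1..k}" for i
    using \<phi>(2)[OF mem[OF that] memc] that by (simp add: x_def u_def)
  have vy: "v < y i" if "i \<in> {1..k}" for i
    using \<phi>(3)[OF memc mem[OF that]] \<pi>in[OF that] by (simp add: y_def v_def)
  have xmono: "x i < x j" if "i \<in> {1..k}" "j \<in> {1..k}" "i < j" for i j
    using \<phi>(2)[OF mem[OF that(1)] mem[OF that(2)]] that by (simp add: x_def)
  have ymono: "y i < y j" if "i \<in> {1..k}" "j \<in> {1..k}" "\<pi> i < \<pi> j" for i j
    using \<phi>(3)[OF mem[OF that(1)] mem[OF that(2)]] that by (simp add: y_def)
  have "\<exists>A\<in>P. x i \<in> A \<and> y i \<in> A \<and> (\<forall>z\<in>A. z \<le> x i \<or> y i \<le> z)" if "i \<in> {1..k}" for i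
    using arc[OF that] unfolding arcs_def by blast
  then have "\<exists>B. \<forall>i\<in>{1..k}. B i \<in> P \<and> x i \<in> B i \<and> y i \<in> B i \<and> (\<forall>z\<in>B i. z \<le> x i \<or> y i \<le> z)"
    by (intro bchoice) blast
  then obtain B where B: "\<And>i. i \<in> {1..k} \<Longrightarrow> B i \<in> P" "\<And>i. i \<in> {1..k} \<Longrightarrow> x i \<in> B i"
    "\<And>i. i \<in> {1..k} \<Longrightarrow> y i \<in> B i" "\<And>i z. i \<in> {1..k} \<Longrightarrow> z \<in> B i \<Longrightarrow> z \<le> x i \<or> y i \<le> z"
    by blast
  define \<rho> where "\<rho> = inv \<pi>"
  have \<rho>: "\<pi> (\<rho> j) = j" "\<rho> (\<pi> j) = j" for j
    using permutes_inverses[OF \<pi>] by (auto simp: \<rho>_def)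
  have \<rho>in: "\<rho> i \<in> {1..k}" if "i \<in> {1..k}" for i
    using that permutes_in_image[OF permutes_inv[OF \<pi>]] by (auto simp: \<rho>_def)
  \<comment> \<open>The left endpoints increase with the index, the right ones with the value of
    \<open>\<pi>\<close>; so the right endpoint in position \<open>j\<close> is that of index
    \<open>\<rho> j\<close>.\<close>
  define f where "f i = (if i \<le> k then x i else y (\<rho> (i - k)))" for i
  have f: "strict_mono_on {1..2 * k} f"
  proof (rule strict_mono_onI)
    fix i j assume ij: "i \<in> {1..2 * k}" "j \<in> {1..2 * k}" "i < j"
    consider "j \<le> k" | "i \<le> k" "k < j" | "k < i" using ij by linarith
    then show "f i < f j"
    proof cases
      case 1 then show ?thesis using ij xmono by (simp add: f_def)
    next
      case 2
      then have "i \<in> {1..k}" "j - k \<in> {1..k}" using ij by auto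
      then have "x i < u" "v < y (\<rho> (j - k))" using xu vy \<rho>in by blast+
      then show ?thesis using 2 uv by (simp add: f_def)
    next
      case 3
      then have "i - k \<in> {1..k}" "j - k \<in> {1..k}" using ij by auto
      then have "\<rho> (i - k) \<in> {1..k}" "\<rho> (j - k) \<in> {1..k}" using \<rho>in by blast+
      then show ?thesis using 3 ij ymono by (simp add: f_def \<rho>)
    qed
  qed
  have f_cases: "\<exists>i\<in>{1..k}. j = i \<and> f j = x i \<or> j = \<pi> i + k \<and> f j = y i" if "j \<in> {1..2 * k}" for j
  proof (cases "j \<le> k")
    case True then show ?thesis using that by (auto simp: f_def)
  next
    case False with that have "j - k \<in> {1..k}" by auto
    with False that show ?thesis using \<rho>in[of "j - k"] by (intro bexI[of _ "\<rho> (j - k)"]) (auto simp: f_def \<rho>)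
  qed
  have f1: "f i = x i" "f (\<pi> i + k) = y i" if "i \<in> {1..k}" for i
    using that \<pi>in[OF that] by (auto simp: f_def \<rho>)
  \<comment> \<open>Within one part, \<open>x j\<close> cannot lie strictly between the consecutive
    elements \<open>x i\<close> and \<open>y i\<close>, and it is below \<open>y i\<close> because
    of the gap from \<open>u\<close> to \<open>v\<close>. By symmetry the left endpoints
    coincide.\<close>
  have same: "i = j" if ij: "i \<in> {1..k}" "j \<in> {1..k}" "B i = B j" for i j
  proof -
    have "x j \<le> x i" using B(4)[OF ij(1), of "x j"] B(2)[OF ij(2)] ij xu[of j] vy[of i] uv by auto
    moreover have "x i \<le> x j" using B(4)[OF ij(2), of "x i"] B(2)[OF ij(1)] ij xu[of i] vy[of j] uv by auto
    ultimately show ?thesis using xmono[of i j] xmono[of j i] ij by (metis leD linorder_neqE_nat)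
  qed
  have Bf: "{j \<in> {1..2 * k}. f j \<in> B i} = {i, \<pi> i + k}" if i: "i \<in> {1..k}" for i
  proof (intro equalityI subsetI)
    fix j assume "j \<in> {i, \<pi> i + k}"
    then show "j \<in> {j \<in> {1..2 * k}. f j \<in> B i}" using i \<pi>in[OF i] f1[OF i] B by auto
  next
    fix j assume j: "j \<in> {j \<in> {1..2 * k}. f j \<in> B i}"
    then obtain i' where i': "i' \<in> {1..k}" "j = i' \<and> f j = x i' \<or> j = \<pi> i' + k \<and> f j = y i'"
      using f_cases[of j] by blast
    then have "f j \<in> B i'" using B by auto
    then have "B i' = B i" using partition_on_same_part[OF P(2) B(1) B(1)] i i' j by blast
    then show "j \<in> {i, \<pi> i + k}" using same i i' by auto
  qed
  have "f ` {1..2 * k} \<subseteq> {1..n}"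
  proof safe
    fix j assume "j \<in> {1..2 * k}"
    then obtain i where "i \<in> {1..k}" "f j \<in> B i" using f_cases[of j] B by metis
    then show "f j \<in> {1..n}" using B(1) P(2) by (auto simp: partition_on_def)
  qed
  then have "induced_subpartition P (f ` {1..2 * k}) \<in> \<P>"
    using her P unfolding hereditary_def by blast
  also have "induced_subpartition P (f ` {1..2 * k}) = perm_partition k \<pi>"
    unfolding induced_subpartition_image[OF f]
  proof (intro equalityI subsetI)
    fix C assume "C \<in> (\<lambda>A. {i \<in> {1..2 * k}. f i \<in> A}) ` P - {{}}"
    then obtain A j where A: "A \<in> P" "C = {i \<in> {1..2 * k}. f i \<in> A}" "j \<in> {1..2 * k}" "f j \<in> A" by auto
    then obtain i where i: "i \<in> {1..k}" "f j \<in> B i" using f_cases[of j] B by metis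
    then have "A = B i" using partition_on_same_part[OF P(2) A(1) B(1)] A by blast
    then show "C \<in> perm_partition k \<pi>" using Bf[OF i(1)] i A(2) by (auto simp: perm_partition_def)
  next
    fix C assume "C \<in> perm_partition k \<pi>"
    then obtain i where i: "i \<in> {1..k}" "C = {i, \<pi> i + k}" by (auto simp: perm_partition_def)
    then show "C \<in> (\<lambda>A. {i \<in> {1..2 * k}. f i \<in> A}) ` P - {{}}"
      using Bf[OF i(1)] B(1)[OF i(1)] by blast
  qed
  finally show ?thesis .
qed

section \<open>Exponential speed when some permutation partition is missing\<close>

lemma finite_level: "finite (level \<P> n)"
proof (rule finite_subset)
  show "level \<P> n \<subseteq> Pow (Pow {1..n})" by (auto simp: level_def partition_on_def)
qed simp

lemma perm_partition_if_superexponential: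
  assumes her: "hereditary \<P>" and sup: "superexponential \<P>" and \<pi>: "\<pi> permutes {1..k}"
  shows "perm_partition k \<pi> \<in> \<P>"
proof (rule ccontr)
  assume not: "perm_partition k \<pi> \<notin> \<P>"
  let ?F = "corner_pattern k \<pi>"
  \<comment> \<open>The pattern occupies rows and columns \<open>1\<close> to \<open>k + 1\<close>,
    hence \<open>k + 2\<close>. The last factor \<open>q\<close> in the exponent of \<open>D\<close>
    pays for rounding \<open>n\<close> up to a power of \<open>q\<close>.\<close>
  define q where "q = (k + 2)\<^sup>2 + 2"
  define c where "c = (k + 2) * 2 ^ q * q\<^sup>2 + 1"
  define D where "D = (2::nat) ^ (q\<^sup>2 * c * q)"
  have "\<pi> i \<le> k" if "i \<in> {1..k}" for i
    using that permutes_in_image[OF \<pi>, of i] by auto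
  then have F: "?F \<subseteq> {..<k + 2} \<times> {..<k + 2}"
    by (force simp: corner_pattern_def)
  have "speed \<P> n \<le> D ^ n" for n
  proof (cases "n = 0")
    case True
    have "level \<P> 0 \<subseteq> {{}}" by (auto simp: level_def partition_on_def)
    then have "speed \<P> 0 \<le> card {{} :: nat set set}"
      unfolding speed_def by (intro card_mono) auto
    with True show ?thesis by simp
  next
    case False
    then obtain m where m: "q ^ m \<le> n" "n < q ^ Suc m"
      using ex_power_ivl1[of q n] by (auto simp: q_def)
    let ?T = "{M. M \<subseteq> {..<q ^ Suc m} \<times> {..<q ^ Suc m} \<and> \<not> pattern_in ?F M}"
    have "inj_on arcs (level \<P> n)"
      by (rule inj_onI) (metis (lifting) arcs_inject level_def mem_Collect_eq)
    moreover have "arcs ` level \<P> n \<subseteq> ?T"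
    proof (intro image_subsetI CollectI conjI notI subrelI)
      fix P x y assume "P \<in> level \<P> n" "(x, y) \<in> arcs P"
      then have "x \<le> n" "y \<le> n" by (auto simp: level_def partition_on_def arcs_def)
      with m show "(x, y) \<in> {..<q ^ Suc m} \<times> {..<q ^ Suc m}" by auto
    next
      fix P assume "P \<in> level \<P> n" "pattern_in ?F (arcs P)"
      then show False
        using not perm_partition_if_pattern_in_arcs[OF her _ _ \<pi>] unfolding level_def by blast
    qed
    moreover have "finite ?T" by (rule finite_subset[of _ "Pow ({..<q ^ Suc m} \<times> {..<q ^ Suc m})"]) auto
    ultimately have "speed \<P> n \<le> card ?T"
      unfolding speed_def by (intro card_inj_on_le)
    also have "\<dots> \<le> 2 ^ (q\<^sup>2 * c * q ^ Suc m)"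
      using card_avoiders_le[OF F q_def, of "Suc m"] by (simp only: c_def)
    also have "\<dots> \<le> 2 ^ (q\<^sup>2 * c * q * n)"
    proof (rule power_increasing)
      show "q\<^sup>2 * c * q ^ Suc m \<le> q\<^sup>2 * c * q * n"
        using mult_le_mono2[OF m(1), of "q\<^sup>2 * c * q"] by (simp add: mult.assoc)
    qed simp
    also have "\<dots> = D ^ n" by (simp add: D_def power_mult)
    finally show ?thesis .
  qed
  then have "real (speed \<P> n) \<le> real D ^ n" for n by (metis of_nat_le_iff of_nat_power)
  moreover have "real D > 0" by (simp add: D_def)
  ultimately show False using sup unfolding superexponential_def by (meson leD)
qed

subsection \<open>Crossing partitions\<close>

text \<open>All pairs lie over a common point. Taking \<open>A = A'\<close> shows that no part has three elements.\<close>
definition crossing :: "nat set set \<Rightarrow> bool" where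
  "crossing P \<longleftrightarrow> (\<forall>A\<in>P. \<forall>A'\<in>P. \<forall>x\<in>A. \<forall>y\<in>A. \<forall>x'\<in>A'. \<forall>y'\<in>A'. x < y \<longrightarrow> x' < y' \<longrightarrow> x < y')"

definition crossing_property :: "nat set set set" where
  "crossing_property = {P. (\<exists>n. partition_on {1..n} P) \<and> crossing P}"

lemma crossingD:
  "crossing P \<Longrightarrow> A \<in> P \<Longrightarrow> A' \<in> P \<Longrightarrow> x \<in> A \<Longrightarrow> y \<in> A \<Longrightarrow> x' \<in> A' \<Longrightarrow> y' \<in> A' \<Longrightarrow> x < y \<Longrightarrow> x' < y' \<Longrightarrow> x < y'"
  unfolding crossing_def by blast

lemma partition_on_preimage:
  assumes P: "partition_on X P" and f: "f ` Y \<subseteq> X"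
  shows "partition_on Y ((\<lambda>A. {i \<in> Y. f i \<in> A}) ` P - {{}})"
proof (rule partition_onI)
  show "\<Union> ((\<lambda>A. {i \<in> Y. f i \<in> A}) ` P - {{}}) = Y"
  proof (intro equalityI subsetI)
    fix i assume i: "i \<in> Y"
    then obtain A where "A \<in> P" "f i \<in> A" using f P unfolding partition_on_def by blast
    with i show "i \<in> \<Union> ((\<lambda>A. {i \<in> Y. f i \<in> A}) ` P - {{}})" by blast
  qed auto
next
  fix C D assume "C \<in> (\<lambda>A. {i \<in> Y. f i \<in> A}) ` P - {{}}" "D \<in> (\<lambda>A. {i \<in> Y. f i \<in> A}) ` P - {{}}" "C \<noteq> D"
  then obtain A B where AB: "A \<in> P" "B \<in> P" "C = {i \<in> Y. f i \<in> A}" "D = {i \<in> Y. f i \<in> B}" "A \<noteq> B" by blast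
  then have "A \<inter> B = {}" using P by (auto simp: partition_on_def disjoint_def)
  with AB show "disjnt C D" by (auto simp: disjnt_def)
qed auto

lemma hereditary_crossing_property: "hereditary crossing_property"
  unfolding hereditary_def
proof (intro conjI ballI allI impI)
  show "partition_property crossing_property"
    by (simp add: partition_property_def crossing_property_def)
next
  fix P n S assume P: "P \<in> crossing_property" "partition_on {1..n} P" and S: "S \<subseteq> {1..n}"
  have fin: "finite S" using S finite_subset by blast
  define f where "f = enum S"
  define m where "m = card S"
  have f: "strict_mono_on {1..m} f" "f ` {1..m} = S"
    using strict_mono_on_enum[OF fin] enum_image[OF fin] by (simp_all add: f_def m_def)
  let ?P = "(\<lambda>A. {i \<in> {1..m}. f i \<in> A}) ` P - {{}}"
  have "induced_subpartition P S = ?P"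
    using induced_subpartition_image[OF f(1), of P] by (simp only: f(2))
  moreover have "partition_on {1..m} ?P"
    using S f(2) by (intro partition_on_preimage[OF P(2)]) simp
  moreover have "crossing ?P"
    unfolding crossing_def
  proof (intro ballI impI)
    fix C C' x y x' y'
    assume C: "C \<in> ?P" "C' \<in> ?P" "x \<in> C" "y \<in> C" "x' \<in> C'" "y' \<in> C'" "x < y" "x' < y'"
    then obtain A A' where A: "A \<in> P" "C = {i \<in> {1..m}. f i \<in> A}" "A' \<in> P" "C' = {i \<in> {1..m}. f i \<in> A'}" by blast
    have mem: "x \<in> {1..m}" "y \<in> {1..m}" "x' \<in> {1..m}" "y' \<in> {1..m}" using A C by auto
    have "f x < f y'"
    proof (rule crossingD)
      show "crossing P" using P(1) by (simp add: crossing_property_def)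
      show "A \<in> P" "A' \<in> P" by fact+
      show "f x \<in> A" "f y \<in> A" "f x' \<in> A'" "f y' \<in> A'" using A C by auto
      show "f x < f y" "f x' < f y'"
        using strict_mono_onD[OF f(1)] mem C by blast+
    qed
    then show "x < y'" using strict_mono_on_less[OF f(1)] mem by blast
  qed
  ultimately show "induced_subpartition P S \<in> crossing_property"
    by (auto simp: crossing_property_def)
qed

text \<open>Parts have at most two elements, so they are the orbits of an involution; the largest
  left endpoint \<open>t\<close> separates the two ends of every pair.\<close>

lemma crossing_involution:
  assumes P: "partition_on {1..n} P" and cr: "crossing P"
  obtains t \<pi> where "\<pi> permutes {1..n}" "\<And>x. \<pi> (\<pi> x) = x" "P = (\<lambda>x. {x, \<pi> x}) ` {1..n}"
    "\<And>x. \<pi> x \<noteq> x \<Longrightarrow> x \<le> t \<longleftrightarrow> t < \<pi> x"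
proof -
  have finA: "finite A" and neA: "A \<noteq> {}" and subA: "A \<subseteq> {1..n}" if "A \<in> P" for A
    using that P finite_subset[of A "{1..n}"] by (auto simp: partition_on_def)
  \<comment> \<open>The left endpoints, with \<open>0\<close> added so that the maximum exists when
    there are no pairs.\<close>
  define L where "L = insert 0 {x. \<exists>A\<in>P. \<exists>y\<in>A. x \<in> A \<and> x < y}"
  have finL: "finite L"
  proof (rule finite_subset)
    show "L \<subseteq> {0..n}" using subA by (fastforce simp: L_def)
  qed simp
  define t where "t = Max L"
  have tL: "t \<in> L" unfolding t_def using finL by (intro Max_in) (auto simp: L_def)
  have t: "x \<le> t \<and> t < y" if "A \<in> P" "x \<in> A" "y \<in> A" "x < y" for A x y
  proof
    have "x \<in> L" using that by (auto simp: L_def)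
    then show "x \<le> t" unfolding t_def using finL by simp
    show "t < y"
      using tL that unfolding L_def by (auto intro: crossingD[OF cr])
  qed
  define lo hi where "lo A = Min A" and "hi A = Max A" for A :: "nat set"
  have lohi: "A = {lo A, hi A}" "lo A \<in> A" "hi A \<in> A" "lo A \<le> hi A" if "A \<in> P" for A
  proof -
    note fn = finA[OF that] neA[OF that]
    show mem: "lo A \<in> A" "hi A \<in> A" using fn by (simp_all add: lo_def hi_def)
    have le: "lo A \<le> z" "z \<le> hi A" if "z \<in> A" for z using fn that by (simp_all add: lo_def hi_def)
    show "lo A \<le> hi A" using le mem by blast
    \<comment> \<open>An element strictly between would be a right endpoint, hence above
      \<open>t\<close>, and a left endpoint, hence at most \<open>t\<close>.\<close>
    have "z = lo A \<or> z = hi A" if z: "z \<in> A" for z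
      using le[OF z] t[OF \<open>A \<in> P\<close> mem(1) z] t[OF \<open>A \<in> P\<close> z mem(2)] by linarith
    with mem show "A = {lo A, hi A}" by blast
  qed
  define B where "B x = (THE A. A \<in> P \<and> x \<in> A)" for x
  have B_eq: "B x = A" if "A \<in> P" "x \<in> A" for A x
    unfolding B_def using that partition_on_same_part[OF P] by (intro the_equality) auto
  have B: "B x \<in> P" "x \<in> B x" if "x \<in> {1..n}" for x
  proof -
    have "x \<in> \<Union>P" using that partition_onD1[OF P] by (rule subst[rotated])
    then obtain A where "A \<in> P" "x \<in> A" by blast
    then show "B x \<in> P" "x \<in> B x" using B_eq by auto
  qed
  \<comment> \<open>Subtraction from \<open>lo + hi\<close> swaps the two elements of a pair and
    fixes a singleton, where \<open>lo\<close> and \<open>hi\<close> coincide.\<close>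
  define \<pi> where "\<pi> x = (if x \<in> {1..n} then lo (B x) + hi (B x) - x else x)" for x
  have \<pi>_swap: "\<pi> (lo A) = hi A" "\<pi> (hi A) = lo A" if "A \<in> P" for A
    using lohi[OF that] B_eq[OF that] subA[OF that] by (auto simp: \<pi>_def)
  have cases: "x \<notin> {1..n} \<or> (\<exists>A\<in>P. x = lo A \<or> x = hi A)" for x
  proof (cases "x \<in> {1..n}")
    case True
    then show ?thesis using lohi(1)[OF B(1)] B by blast
  qed simp
  have inv: "\<pi> (\<pi> x) = x" for x
    using cases[of x]
  proof
    assume "x \<notin> {1..n}" then show ?thesis unfolding \<pi>_def by presburger
  qed (use \<pi>_swap in auto)
  show thesis
  proof
    show "\<pi> permutes {1..n}"
      unfolding permutes_def
    proof (intro conjI allI impI)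
      show "\<exists>!x. \<pi> x = y" for y using inv by metis
    qed (auto simp: \<pi>_def)
    show "\<pi> (\<pi> x) = x" for x by (rule inv)
    show "P = (\<lambda>x. {x, \<pi> x}) ` {1..n}"
    proof (intro equalityI subsetI)
      fix A assume A: "A \<in> P"
      then have "A = {lo A, \<pi> (lo A)}" "lo A \<in> {1..n}"
        using lohi[OF A] \<pi>_swap[OF A] subA[OF A] by auto
      then show "A \<in> (\<lambda>x. {x, \<pi> x}) ` {1..n}" by blast
    next
      fix A assume "A \<in> (\<lambda>x. {x, \<pi> x}) ` {1..n}"
      then obtain x where x: "x \<in> {1..n}" "A = {x, \<pi> x}" by blast
      have "x = lo (B x) \<or> x = hi (B x)" using lohi(1)[OF B(1)[OF x(1)]] B(2)[OF x(1)] by blast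
      then have "A = {lo (B x), hi (B x)}"
        using \<pi>_swap[OF B(1)[OF x(1)]] x(2) by (metis insert_commute)
      then show "A \<in> P" using lohi(1)[OF B(1)[OF x(1)]] B(1)[OF x(1)] by simp
    qed
    show "x \<le> t \<longleftrightarrow> t < \<pi> x" if ne: "\<pi> x \<noteq> x" for x
    proof -
      have "x \<in> {1..n}" using ne unfolding \<pi>_def by presburger
      then obtain A where A: "A \<in> P" "x = lo A \<or> x = hi A" using cases by blast
      then have "lo A < hi A" using \<pi>_swap[OF A(1)] lohi(4)[OF A(1)] ne by auto
      then have "lo A \<le> t" "t < hi A" using t A(1) lohi(2,3)[OF A(1)] by blast+
      with A \<pi>_swap[OF A(1)] show ?thesis by auto
    qed
  qed
qed

text \<open>If \<open>\<pi>\<close> is the involution exchanging the elements of each pair and all pairs lie over \<open>t\<close>, then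
  \<open>{1..t} \<union> {n + t + 1..2 * n}\<close> induces the given partition in \<open>H(\<pi>)\<close>.\<close>
lemma crossing_property_subset:
  assumes her: "hereditary \<P>" and all: "\<And>k \<pi>. \<pi> permutes {1..k} \<Longrightarrow> perm_partition k \<pi> \<in> \<P>"
  shows "crossing_property \<subseteq> \<P>"
proof
  fix P assume "P \<in> crossing_property"
  then obtain n where P: "partition_on {1..n} P" and cr: "crossing P"
    by (auto simp: crossing_property_def)
  obtain t \<pi> where \<pi>: "\<pi> permutes {1..n}" "\<And>x. \<pi> (\<pi> x) = x" "P = (\<lambda>x. {x, \<pi> x}) ` {1..n}"
    "\<And>x. \<pi> x \<noteq> x \<Longrightarrow> x \<le> t \<longleftrightarrow> t < \<pi> x"
    using crossing_involution[OF P cr] by blast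
  let ?H = "perm_partition n \<pi>"
  have H: "?H \<in> \<P>" by (rule all[OF \<pi>(1)])
  then obtain N where N: "partition_on {1..N} ?H"
    using her unfolding hereditary_def partition_property_def by blast
  have \<pi>in: "\<pi> x \<in> {1..n} \<longleftrightarrow> x \<in> {1..n}" for x by (rule permutes_in_image[OF \<pi>(1)])
  define f where "f i = (if i \<le> t then i else i + n)" for i
  have f: "strict_mono_on {1..n} f" by (rule strict_mono_onI) (auto simp: f_def)
  have Hin: "{j, \<pi> j + n} \<in> ?H" if "j \<in> {1..n}" for j using that by (auto simp: perm_partition_def)
  have "f ` {1..n} \<subseteq> \<Union> ?H"
  proof
    fix y assume "y \<in> f ` {1..n}"
    then obtain i where i: "i \<in> {1..n}" "y = f i" by blast
    \<comment> \<open>A point \<open>i > t\<close> is represented by its right copy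
      \<open>i + n\<close>, which lies in the part of \<open>\<pi> i\<close> because
      \<open>\<pi>\<close> is an involution.\<close>
    have "y \<in> {i, \<pi> i + n} \<or> y \<in> {\<pi> i, \<pi> (\<pi> i) + n}" using i \<pi>(2) by (auto simp: f_def)
    then show "y \<in> \<Union> ?H" using Hin[OF i(1)] Hin[of "\<pi> i"] \<pi>in i(1) by blast
  qed
  also have "\<Union> ?H = {1..N}" using N by (simp add: partition_on_def)
  finally have "induced_subpartition ?H (f ` {1..n}) \<in> \<P>"
    using her H N unfolding hereditary_def by blast
  also have "induced_subpartition ?H (f ` {1..n}) = (\<lambda>A. {i \<in> {1..n}. f i \<in> A}) ` ?H - {{}}"
    by (rule induced_subpartition_image[OF f])
  also have "\<dots> = P"
  proof -
    \<comment> \<open>The part of a left endpoint keeps both its points, that of a right endpoint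
      loses both, and that of a fixed point keeps exactly one. So each pair of \<open>P\<close>
      arises once.\<close>
    have pre: "{i \<in> {1..n}. f i \<in> {j, \<pi> j + n}} = {i. i = j \<and> j \<le> t \<or> i = \<pi> j \<and> t < \<pi> j}" if "j \<in> {1..n}" for j
      using that \<pi>in[of j] by (auto simp: f_def)
    have pre1: "{i \<in> {1..n}. f i \<in> {j, \<pi> j + n}} = {j, \<pi> j}" if "j \<in> {1..n}" "j \<le> t \<or> \<pi> j = j" for j
      unfolding pre[OF that(1)] using that(2) \<pi>(4)[of j] by force
    have pre2: "{i \<in> {1..n}. f i \<in> {j, \<pi> j + n}} = {}" if "j \<in> {1..n}" "\<not> (j \<le> t \<or> \<pi> j = j)" for j
      unfolding pre[OF that(1)] using that(2) \<pi>(4)[of j] by force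
    show ?thesis
    proof (intro equalityI subsetI)
      fix C assume "C \<in> (\<lambda>A. {i \<in> {1..n}. f i \<in> A}) ` ?H - {{}}"
      then obtain j where "j \<in> {1..n}" "C = {i \<in> {1..n}. f i \<in> {j, \<pi> j + n}}" "C \<noteq> {}"
        by (auto simp: perm_partition_def)
      then show "C \<in> P" using pre1[of j] pre2[of j] unfolding \<pi>(3) by blast
    next
      fix A assume "A \<in> P"
      then obtain x where x: "x \<in> {1..n}" "A = {x, \<pi> x}" unfolding \<pi>(3) by blast
      have "\<exists>j\<in>{1..n}. A = {j, \<pi> j} \<and> (j \<le> t \<or> \<pi> j = j)"
      proof (cases "x \<le> t \<or> \<pi> x = x")
        case False
        then have "\<pi> x \<le> t" using \<pi>(4)[of x] by auto
        then show ?thesis using x \<pi>(2) \<pi>in by (intro bexI[of _ "\<pi> x"]) auto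
      qed (use x in blast)
      then obtain j where j: "j \<in> {1..n}" "A = {j, \<pi> j}" "j \<le> t \<or> \<pi> j = j" by blast
      have "A = {i \<in> {1..n}. f i \<in> {j, \<pi> j + n}}" using pre1[OF j(1,3)] j(2) by simp
      moreover have "A \<noteq> {}" using j(2) by simp
      ultimately show "A \<in> (\<lambda>A. {i \<in> {1..n}. f i \<in> A}) ` ?H - {{}}" using Hin[OF j(1)] by blast
    qed
  qed
  finally show "P \<in> \<P>" .
qed

subsection \<open>Speed of the crossing property\<close>

definition crossing_data :: "nat \<Rightarrow> (nat \<times> nat set \<times> (nat \<Rightarrow> nat)) set" where
  "crossing_data n = (SIGMA k:{0..n div 2}. {T. T \<subseteq> {1..n} \<and> card T = 2 * k} \<times> {\<sigma>. \<sigma> permutes {1..k}})"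

text \<open>In a crossing partition the paired elements \<open>T\<close> have all \<open>k\<close> left endpoints below all \<open>k\<close> right
  endpoints, so that the pairing is a permutation of \<open>{1..k}\<close>.\<close>
definition crossing_of :: "nat \<Rightarrow> nat \<times> nat set \<times> (nat \<Rightarrow> nat) \<Rightarrow> nat set set" where
  "crossing_of n = (\<lambda>(k, T, \<sigma>). (\<lambda>i. {enum T i, enum T (k + \<sigma> i)}) ` {1..k} \<union> (\<lambda>x. {x}) ` ({1..n} - T))"

lemma card_crossing_data: "card (crossing_data n) = min_speed n"
proof -
  have "finite {T. T \<subseteq> {1..n} \<and> card T = 2 * k}" for k
    by (rule finite_subset[of _ "Pow {1..n}"]) auto
  then have "card (crossing_data n) = (\<Sum>k\<in>{0..n div 2}. card ({T. T \<subseteq> {1..n} \<and> card T = 2 * k} \<times> {\<sigma>. \<sigma> permutes {1..k}}))"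
    unfolding crossing_data_def by (intro card_SigmaI) (auto simp: finite_permutations)
  also have "\<dots> = min_speed n"
    unfolding min_speed_def card_cartesian_product
    by (intro sum.cong refl) (simp add: n_subsets card_permutations)
  finally show ?thesis .
qed

context
  fixes n k T \<sigma>
  assumes data: "(k, T, \<sigma>) \<in> crossing_data n"
begin

lemma
  shows crossing_data_strict_mono: "strict_mono_on {1..2 * k} (enum T)"
    and crossing_data_image: "enum T ` {1..2 * k} = T"
    and crossing_data_subset: "T \<subseteq> {1..n}"
    and crossing_data_permutes: "\<sigma> permutes {1..k}"
proof -
  have T: "T \<subseteq> {1..n}" "card T = 2 * k" "\<sigma> permutes {1..k}" using data by (auto simp: crossing_data_def)
  then have "finite T" using finite_subset by blast
  with T show "strict_mono_on {1..2 * k} (enum T)" "enum T ` {1..2 * k} = T" "T \<subseteq> {1..n}" "\<sigma> permutes {1..k}"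
    using strict_mono_on_enum[of T] enum_image[of T] by auto
qed

lemma crossing_data_range: "i \<in> {1..k} \<Longrightarrow> i \<in> {1..2 * k} \<and> k + \<sigma> i \<in> {1..2 * k} \<and> \<sigma> i \<in> {1..k}"
  using permutes_in_image[OF crossing_data_permutes, of i] by auto

lemma crossing_data_less:
  assumes "i \<in> {1..k}" "j \<in> {1..k}"
  shows "enum T i < enum T (k + \<sigma> j)"
  using assms crossing_data_range[OF assms(1)] crossing_data_range[OF assms(2)]
  by (intro strict_mono_onD[OF crossing_data_strict_mono]) auto

lemma crossing_data_inj: "i \<in> {1..2 * k} \<Longrightarrow> j \<in> {1..2 * k} \<Longrightarrow> enum T i = enum T j \<Longrightarrow> i = j"
  using strict_mono_on_imp_inj_on[OF crossing_data_strict_mono] by (rule inj_onD)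

lemma crossing_data_same_pair:
  assumes ij: "i \<in> {1..k}" "j \<in> {1..k}" and x: "x \<in> {enum T i, enum T (k + \<sigma> i)}" "x \<in> {enum T j, enum T (k + \<sigma> j)}"
  shows "i = j"
proof -
  consider "enum T i = enum T j" | "enum T (k + \<sigma> i) = enum T (k + \<sigma> j)"
    using x crossing_data_less[OF ij] crossing_data_less[OF ij(2,1)] by auto
  then show ?thesis
  proof cases
    case 1 then show ?thesis using crossing_data_inj crossing_data_range ij by blast
  next
    case 2
    then have "k + \<sigma> i = k + \<sigma> j" using crossing_data_inj crossing_data_range ij by blast
    then show ?thesis using permutes_inj[OF crossing_data_permutes] by (simp add: inj_eq)
  qed
qed

lemma crossing_of_covers: "(\<Union>i\<in>{1..k}. {enum T i, enum T (k + \<sigma> i)}) = T"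
proof (intro equalityI subsetI)
  fix x assume "x \<in> (\<Union>i\<in>{1..k}. {enum T i, enum T (k + \<sigma> i)})"
  then show "x \<in> T" using crossing_data_range crossing_data_image by blast
next
  fix x assume "x \<in> T"
  then obtain j where j: "j \<in> {1..2 * k}" "x = enum T j" using crossing_data_image by blast
  show "x \<in> (\<Union>i\<in>{1..k}. {enum T i, enum T (k + \<sigma> i)})"
  proof (cases "j \<le> k")
    case True then show ?thesis using j by auto
  next
    case False
    then have "j - k \<in> \<sigma> ` {1..k}" using j permutes_image[OF crossing_data_permutes] by auto
    then obtain i where "i \<in> {1..k}" "j = k + \<sigma> i" using False by auto
    then show ?thesis using j by blast
  qed
qed

lemma crossing_of_in_level: "crossing_of n (k, T, \<sigma>) \<in> level crossing_property n"
proof -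
  let ?P = "crossing_of n (k, T, \<sigma>)"
  have P: "?P = (\<lambda>i. {enum T i, enum T (k + \<sigma> i)}) ` {1..k} \<union> (\<lambda>x. {x}) ` ({1..n} - T)"
    by (simp add: crossing_of_def)
  have "partition_on {1..n} ?P"
  proof (rule partition_onI)
    have "\<Union> ?P = T \<union> ({1..n} - T)" unfolding P using crossing_of_covers by auto
    then show "\<Union> ?P = {1..n}" using crossing_data_subset by auto
  next
    fix A B assume AB: "A \<in> ?P" "B \<in> ?P" "A \<noteq> B"
    have *: "{enum T i, enum T (k + \<sigma> i)} \<subseteq> T" if "i \<in> {1..k}" for i
      using crossing_of_covers that by blast
    have "A = B" if x: "x \<in> A" "x \<in> B" for x
    proof (cases "x \<in> T")
      case True
      then obtain i j where "i \<in> {1..k}" "A = {enum T i, enum T (k + \<sigma> i)}"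
        "j \<in> {1..k}" "B = {enum T j, enum T (k + \<sigma> j)}" using AB x unfolding P by blast
      then show ?thesis using crossing_data_same_pair x by blast
    next
      case False
      then show ?thesis using AB x * unfolding P by blast
    qed
    with AB(3) show "disjnt A B" by (auto simp: disjnt_iff)
  qed (auto simp: P)
  moreover have "crossing ?P"
  proof -
    have pair: "\<exists>i\<in>{1..k}. x = enum T i \<and> y = enum T (k + \<sigma> i)" if xy: "A \<in> ?P" "x \<in> A" "y \<in> A" "x < y" for A x y
    proof -
      have "A \<notin> (\<lambda>x. {x}) ` ({1..n} - T)" using xy by auto
      then obtain i where i: "i \<in> {1..k}" "A = {enum T i, enum T (k + \<sigma> i)}"
        using xy(1) unfolding P by blast
      with crossing_data_less[OF i(1) i(1)] xy show ?thesis by auto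
    qed
    show ?thesis unfolding crossing_def
    proof (intro ballI impI)
      fix A A' x y x' y' assume a: "A \<in> ?P" "A' \<in> ?P" "x \<in> A" "y \<in> A" "x' \<in> A'" "y' \<in> A'" "x < y" "x' < y'"
      show "x < y'"
        using pair[of A x y] pair[of A' x' y'] a crossing_data_less by blast
    qed
  qed
  ultimately show ?thesis by (auto simp: level_def crossing_property_def)
qed

lemma crossing_of_unpaired: "T = {x \<in> {1..n}. {x} \<notin> crossing_of n (k, T, \<sigma>)}"
proof -
  have "{x} \<in> crossing_of n (k, T, \<sigma>) \<longleftrightarrow> x \<in> {1..n} - T" for x
  proof
    assume "{x} \<in> crossing_of n (k, T, \<sigma>)"
    moreover have "{x} \<noteq> {enum T i, enum T (k + \<sigma> i)}" if "i \<in> {1..k}" for i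
      using crossing_data_less[OF that that] by auto
    ultimately show "x \<in> {1..n} - T" by (auto simp: crossing_of_def)
  qed (auto simp: crossing_of_def)
  then show ?thesis using crossing_data_subset by auto
qed

end

text \<open>\<open>T\<close> consists of the points that do not form singleton parts,
  \<open>k\<close> is half its size, and \<open>\<sigma>\<close> is read off from the upper partner
  of each lower point.\<close>

lemma inj_on_crossing_of: "inj_on (crossing_of n) (crossing_data n)"
proof (rule inj_onI)
  fix a b assume ab: "a \<in> crossing_data n" "b \<in> crossing_data n" "crossing_of n a = crossing_of n b"
  obtain k T \<sigma> where a: "a = (k, T, \<sigma>)" by (cases a)
  obtain k' T' \<sigma>' where b: "b = (k', T', \<sigma>')" by (cases b)
  have T: "T' = T" using crossing_of_unpaired[of k T \<sigma> n] crossing_of_unpaired[of k' T' \<sigma>' n] ab a b by simp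
  have k: "k' = k" using ab a b T by (auto simp: crossing_data_def)
  note A = ab(1)[unfolded a] and B = ab(2)[unfolded b T k]
  have "\<sigma> i = \<sigma>' i" for i
  proof (cases "i \<in> {1..k}")
    case False
    then show ?thesis using crossing_data_permutes[OF A] crossing_data_permutes[OF B] by (simp add: permutes_not_in)
  next
    case i: True
    have "{enum T i, enum T (k + \<sigma> i)} \<in> crossing_of n (k, T, \<sigma>)"
      using i unfolding crossing_of_def by blast
    then have "{enum T i, enum T (k + \<sigma> i)} \<in> crossing_of n (k, T, \<sigma>')"
      using ab(3) unfolding a b T k by simp
    moreover have "{enum T i, enum T (k + \<sigma> i)} \<noteq> {x}" for x
      using crossing_data_less[OF A i i] by auto
    ultimately obtain j where j: "j \<in> {1..k}" "{enum T i, enum T (k + \<sigma> i)} = {enum T j, enum T (k + \<sigma>' j)}"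
      unfolding crossing_of_def by auto
    \<comment> \<open>Both doubletons have their smaller element first, so they can only be equal
      componentwise.\<close>
    then have "enum T i = enum T j" "enum T (k + \<sigma> i) = enum T (k + \<sigma>' j)"
      using crossing_data_less[OF A i i] crossing_data_less[OF B j(1) j(1)]
      by (auto simp: doubleton_eq_iff)
    moreover from this(1) have "i = j"
      using crossing_data_inj[OF A] crossing_data_range[OF A] i j(1) by blast
    ultimately have "k + \<sigma> i = k + \<sigma>' i"
      using crossing_data_inj[OF A] crossing_data_range[OF A i] crossing_data_range[OF B i] by blast
    then show ?thesis by simp
  qed
  then show "a = b" using a b T k by auto
qed

text \<open>The involution exchanges the halves \<open>L\<close> and \<open>R\<close> of the set
  \<open>T\<close> of moved points. So \<open>T\<close> has \<open>2 * k\<close> elements, its first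
  \<open>k\<close> form \<open>L\<close>, and \<open>\<sigma>\<close> records which position in
  \<open>R\<close> is the partner.\<close>

lemma level_crossing_property_subset: "level crossing_property n \<subseteq> crossing_of n ` crossing_data n"
proof
  fix P assume "P \<in> level crossing_property n"
  then have P: "partition_on {1..n} P" and cr: "crossing P" by (auto simp: level_def crossing_property_def)
  obtain t \<pi> where \<pi>: "\<pi> permutes {1..n}" "\<And>x. \<pi> (\<pi> x) = x" "P = (\<lambda>x. {x, \<pi> x}) ` {1..n}"
    "\<And>x. \<pi> x \<noteq> x \<Longrightarrow> x \<le> t \<longleftrightarrow> t < \<pi> x"
    using crossing_involution[OF P cr] by blast
  have \<pi>in: "\<pi> x \<in> {1..n} \<longleftrightarrow> x \<in> {1..n}" for x by (rule permutes_in_image[OF \<pi>(1)])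
  have \<pi>inj: "\<pi> x = \<pi> y \<Longrightarrow> x = y" for x y using \<pi>(2) by metis
  define T where "T = {x \<in> {1..n}. \<pi> x \<noteq> x}"
  define L where "L = {x \<in> T. x \<le> t}"
  define R where "R = {x \<in> T. t < x}"
  define k where "k = card L"
  have \<pi>T: "\<pi> x \<in> T \<longleftrightarrow> x \<in> T" for x using \<pi>in \<pi>(2) by (auto simp: T_def)
  have \<pi>t: "\<pi> x \<le> t \<longleftrightarrow> t < x" if "x \<in> T" for x
    using \<pi>(4)[of x] that by (auto simp: T_def)
  have fin: "finite T" "finite L" "finite R" by (simp_all add: T_def L_def R_def)
  have "R = \<pi> ` L"
  proof (intro equalityI subsetI)
    fix x assume "x \<in> R"
    then have "\<pi> x \<in> L" using \<pi>T \<pi>t by (auto simp: L_def R_def)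
    then show "x \<in> \<pi> ` L" using \<pi>(2)[of x] by (metis imageI)
  next
    fix x assume "x \<in> \<pi> ` L"
    then show "x \<in> R" using \<pi>T \<pi>t by (fastforce simp: L_def R_def)
  qed
  then have "card R = k" using \<pi>inj by (auto simp: k_def card_image inj_on_def)
  moreover have "T = L \<union> R" "L \<inter> R = {}" by (auto simp: L_def R_def)
  ultimately have cardT: "card T = 2 * k" using card_Un_disjoint[of L R] fin by (simp add: k_def)
  have Tn: "T \<subseteq> {1..n}" by (auto simp: T_def)
  then have "card T \<le> n" using card_mono[of "{1..n}" T] by simp
  then have kn: "k \<le> n div 2" using cardT by simp
  let ?e = "enum T"
  have e: "strict_mono_on {1..2 * k} ?e" "?e ` {1..2 * k} = T"
    using strict_mono_on_enum[OF fin(1)] enum_image[OF fin(1)] by (simp_all add: cardT)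
  have einj: "inj_on ?e {1..2 * k}" by (rule strict_mono_on_imp_inj_on[OF e(1)])
  \<comment> \<open>This index set is closed downwards and has as many elements as \<open>L\<close>,
    namely \<open>k\<close>.\<close>
  have "{i \<in> {1..2 * k}. ?e i \<le> t} = {1..k}"
  proof (rule card_subset_eq)
    let ?D = "{i \<in> {1..2 * k}. ?e i \<le> t}"
    have "x \<in> ?e ` ?D \<longleftrightarrow> x \<in> ?e ` {1..2 * k} \<and> x \<le> t" for x by blast
    then have L: "?e ` ?D = L" unfolding e(2) L_def by auto
    have "inj_on ?e ?D" using einj by (rule inj_on_subset) auto
    then have "card (?e ` ?D) = card ?D" by (rule card_image)
    then have card: "card ?D = k" unfolding L by (simp only: k_def)
    then show "card ?D = card {1..k}" by simp
    show "?D \<subseteq> {1..k}"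
    proof
      fix i assume i: "i \<in> ?D"
      have "{1..i} \<subseteq> ?D"
      proof
        fix j assume j: "j \<in> {1..i}"
        then have "?e j \<le> ?e i" using strict_mono_on_leD[OF e(1), of j i] i by auto
        then show "j \<in> ?D" using i j by auto
      qed
      then have "i \<le> card ?D" using card_mono[of ?D "{1..i}"] by simp
      then show "i \<in> {1..k}" using i unfolding card by auto
    qed
  qed simp
  then have "i \<in> {i \<in> {1..2 * k}. ?e i \<le> t} \<longleftrightarrow> i \<in> {1..k}" for i by (rule arg_cong)
  then have et: "?e i \<le> t \<longleftrightarrow> i \<le> k" if "i \<in> {1..2 * k}" for i
    using that by (metis (lifting) atLeastAtMost_iff mem_Collect_eq)
  have exL: "\<exists>i\<in>{1..k}. x = ?e i" if x: "x \<in> L" for x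
  proof -
    have "x \<in> T" "x \<le> t" using x by (simp_all add: L_def)
    then obtain i where "i \<in> {1..2 * k}" "x = ?e i" using e(2) by blast
    with \<open>x \<le> t\<close> et[of i] show ?thesis by auto
  qed
  have "\<exists>j\<in>{1..k}. ?e (k + j) = \<pi> (?e i)" if i: "i \<in> {1..k}" for i
  proof -
    have i2: "i \<in> {1..2 * k}" using i by auto
    then have T: "?e i \<in> T" using e(2) by blast
    then obtain j where j: "j \<in> {1..2 * k}" "\<pi> (?e i) = ?e j" using \<pi>T[of "?e i"] e(2) by blast
    have "\<not> j \<le> k" using et[OF i2] et[OF j(1)] \<pi>t[OF T] i j by auto
    then show ?thesis using j by (intro bexI[of _ "j - k"]) auto
  qed
  then obtain s where s: "\<And>i. i \<in> {1..k} \<Longrightarrow> s i \<in> {1..k}" "\<And>i. i \<in> {1..k} \<Longrightarrow> ?e (k + s i) = \<pi> (?e i)"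
    by metis
  \<comment> \<open>The identity outside \<open>{1..k}\<close> is what \<open>permutes\<close>
    demands.\<close>
  define \<sigma> where "\<sigma> i = (if i \<in> {1..k} then s i else i)" for i
  have \<sigma>e: "?e (k + \<sigma> i) = \<pi> (?e i)" if "i \<in> {1..k}" for i using s that by (simp add: \<sigma>_def)
  have "inj_on \<sigma> {1..k}"
  proof (rule inj_onI)
    fix i j assume ij: "i \<in> {1..k}" "j \<in> {1..k}" "\<sigma> i = \<sigma> j"
    then have "?e i = ?e j" using \<sigma>e \<pi>inj by metis
    then show "i = j" using inj_onD[OF einj, of i j] ij by auto
  qed
  moreover have "\<sigma> ` {1..k} \<subseteq> {1..k}" using s(1) by (auto simp: \<sigma>_def)
  ultimately have "bij_betw \<sigma> {1..k} {1..k}" by (simp add: bij_betw_def endo_inj_surj)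
  then have "\<sigma> permutes {1..k}" by (rule bij_imp_permutes) (auto simp: \<sigma>_def)
  then have data: "(k, T, \<sigma>) \<in> crossing_data n"
    using kn cardT by (auto simp: crossing_data_def T_def)
  have "crossing_of n (k, T, \<sigma>) = (\<lambda>x. {x, \<pi> x}) ` {1..n}"
  proof (intro equalityI subsetI)
    fix A assume "A \<in> crossing_of n (k, T, \<sigma>)"
    then consider i where "i \<in> {1..k}" "A = {?e i, ?e (k + \<sigma> i)}" | x where "x \<in> {1..n} - T" "A = {x}"
      by (auto simp: crossing_of_def)
    then show "A \<in> (\<lambda>x. {x, \<pi> x}) ` {1..n}"
    proof cases
      case 1
      then have "i \<in> {1..2 * k}" by auto
      then have "?e i \<in> {1..n}" using e(2) Tn by blast
      moreover have "A = {?e i, \<pi> (?e i)}" using 1 \<sigma>e by simp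
      ultimately show ?thesis by (rule rev_image_eqI)
    next
      case 2
      then show ?thesis by (intro image_eqI[of _ _ x]) (auto simp: T_def)
    qed
  next
    fix A assume "A \<in> (\<lambda>x. {x, \<pi> x}) ` {1..n}"
    then obtain x where x: "x \<in> {1..n}" "A = {x, \<pi> x}" by blast
    have L: "{x, \<pi> x} \<in> crossing_of n (k, T, \<sigma>)" if xL: "x \<in> L" for x
    proof -
      obtain i where "i \<in> {1..k}" "x = ?e i" using exL[OF xL] by blast
      then show ?thesis using \<sigma>e[of i] by (auto simp: crossing_of_def)
    qed
    consider "x \<notin> T" | "x \<in> L" | "x \<in> T" "\<pi> x \<in> L" using \<pi>T \<pi>t by (force simp: L_def)
    then show "A \<in> crossing_of n (k, T, \<sigma>)"
    proof cases
      case 1 then show ?thesis using x by (auto simp: crossing_of_def T_def)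
    next
      case 2 then show ?thesis using L x by simp
    next
      case 3 then show ?thesis using L[of "\<pi> x"] x \<pi>(2) by (simp add: insert_commute)
    qed
  qed
  then show "P \<in> crossing_of n ` crossing_data n" using data \<pi>(3) by (metis imageI)
qed

lemma speed_crossing_property: "speed crossing_property n = min_speed n"
proof -
  have "level crossing_property n = crossing_of n ` crossing_data n"
    using level_crossing_property_subset crossing_of_in_level by force
  then show ?thesis
    unfolding speed_def by (simp add: card_image[OF inj_on_crossing_of] card_crossing_data)
qed

section \<open>Growth of the minimal speed\<close>

lemma fact_le_min_speed: "fact (n div 2) \<le> min_speed n"
proof -
  have "(1::nat) * fact (n div 2) \<le> (n choose (2 * (n div 2))) * fact (n div 2)"
    by (intro mult_right_mono) (simp_all add: Suc_le_eq)
  also have "\<dots> \<le> min_speed n"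
    unfolding min_speed_def by (rule member_le_sum) auto
  finally show ?thesis by simp
qed

lemma min_speed_le: "min_speed n \<le> 2 ^ n * fact (n div 2)"
proof -
  have "min_speed n \<le> (\<Sum>k = 0..n div 2. (n choose (2 * k)) * fact (n div 2))"
    unfolding min_speed_def by (intro sum_mono mult_left_mono fact_mono_nat) auto
  also have "\<dots> = (\<Sum>k = 0..n div 2. n choose (2 * k)) * fact (n div 2)" by (simp add: sum_distrib_right)
  also have "(\<Sum>k = 0..n div 2. n choose (2 * k)) = (\<Sum>j\<in>(*) 2 ` {0..n div 2}. n choose j)"
    by (simp add: sum.reindex inj_on_def)
  also have "\<dots> \<le> (\<Sum>j\<le>n. n choose j)" by (intro sum_mono2) auto
  also have "\<dots> = 2 ^ n" by (rule choose_row_sum)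
  finally show ?thesis by simp
qed

text \<open>At \<open>N = 2 * m\<close> the speed is at least \<open>m!\<close>, which eventually
  beats \<open>(c\<^sup>2) ^ m\<close>, since the terms of the exponential series tend to
  zero.\<close>

lemma superexponential_if_speed_eq:
  assumes "\<And>n. speed \<P> n = min_speed n"
  shows "superexponential \<P>"
  unfolding superexponential_def
proof (intro allI impI)
  fix c :: real assume "c > 0"
  have "(\<lambda>m. (c\<^sup>2) ^ m / fact m) \<longlonglongrightarrow> 0"
    using summable_LIMSEQ_zero[OF summable_exp[of "c\<^sup>2"]] by (simp add: divide_inverse mult.commute)
  then have "eventually (\<lambda>m. (c\<^sup>2) ^ m / fact m < 1) sequentially" by (rule order_tendstoD) simp
  then obtain m where "(c\<^sup>2) ^ m / fact m < 1" using eventually_happens'[OF sequentially_bot] by blast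
  then have "c ^ (2 * m) < fact m" by (simp add: power_mult)
  also have "fact m \<le> real (min_speed (2 * m))"
    using fact_le_min_speed[of "2 * m"] by (metis nonzero_mult_div_cancel_left of_nat_fact of_nat_le_iff zero_neq_numeral)
  finally show "\<exists>N. c ^ N < real (speed \<P> N)" using assms by auto
qed

text \<open>A weak form of Stirling's formula: \<open>m ^ m / m!\<close> is a single term of the
  series for \<open>exp m\<close>.\<close>

lemma ln_fact_ge: "real m * (ln (real m) - 1) \<le> ln (fact m)" 
proof (cases "m = 0")
  case False
  have "real m ^ m / fact m \<le> exp (real m)"
  proof -
    have "real m ^ m / fact m = (\<Sum>i\<in>{m}. real m ^ i /\<^sub>R fact i)" by (simp add: field_simps)
    also have "\<dots> \<le> exp (real m)"
      unfolding exp_def by (rule sum_le_suminf[OF summable_exp_generic]) auto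
    finally show ?thesis .
  qed
  then have "ln (real m ^ m / fact m) \<le> ln (exp (real m))" using False by (subst ln_le_cancel_iff) auto
  then show ?thesis using False by (simp add: ln_div ln_realpow algebra_simps)
qed simp

lemma min_speed_asymp:
  "\<exists>\<epsilon>::nat \<Rightarrow> real. \<epsilon> \<in> o(\<lambda>n. real n) \<and> (\<forall>n\<ge>1. real (min_speed n) = real n powr (real n / 2 + \<epsilon> n))"
proof -
  \<comment> \<open>The required identity is solved for the error, so that mainly
    \<open>\<epsilon> \<in> o(n)\<close> remains to be shown.\<close>
  define \<epsilon> where "\<epsilon> n = ln (real (min_speed n)) / ln (real n) - real n / 2" for n
  have pos: "real (min_speed n) > 0" for n
    using fact_le_min_speed[of n] fact_gt_zero[of "n div 2", where 'a = nat] by linarith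
  have "real (min_speed n) = real n powr (real n / 2 + \<epsilon> n)" if "n \<ge> 1" for n
  \<comment> \<open>Here \<open>ln n = 0\<close> and the quotient in \<open>\<epsilon>\<close> is
    degenerate, but \<open>min_speed 1 = 1\<close> equals any power of \<open>1\<close>.\<close>
  proof (cases "n = 1")
    case True then show ?thesis by (simp add: min_speed_def)
  next
    case False
    with that have "ln (real n) > 0" by simp
    then show ?thesis using pos[of n] that by (simp add: \<epsilon>_def powr_def)
  qed
  moreover have "\<epsilon> \<in> o(\<lambda>n. real n)"
  proof (rule smalloI_tendsto)
    have up: "ln (real (min_speed n)) \<le> real n * ln 2 + real n / 2 * ln (real n)" if "n \<ge> 2" for n
    proof -
      have "real (min_speed n) \<le> 2 ^ n * fact (n div 2)"
        using of_nat_mono[OF min_speed_le[of n], where 'a = real] by simp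
      also have "\<dots> \<le> 2 ^ n * real n ^ (n div 2)"
      proof (intro mult_left_mono)
        have "fact (n div 2) \<le> real ((n div 2) ^ (n div 2))"
          by (rule fact_le_power)
        also have "\<dots> \<le> real n ^ (n div 2)" by (simp add: power_mono)
        finally show "fact (n div 2) \<le> real n ^ (n div 2)" .
      qed simp
      finally have "ln (real (min_speed n)) \<le> ln (2 ^ n * real n ^ (n div 2))"
        using pos[of n] that by (subst ln_le_cancel_iff) auto
      also have "\<dots> = real n * ln 2 + real (n div 2) * ln (real n)"
        using that by (simp add: ln_mult ln_realpow)
      also have "\<dots> \<le> real n * ln 2 + real n / 2 * ln (real n)"
        using that by (intro add_left_mono mult_right_mono) auto
      finally show ?thesis .
    qed
    \<comment> \<open>Using \<open>(n - 1) / 2\<close> removes the floor, so that the limit becomes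
      elementary. For \<open>n \<ge> 8\<close> it is at least \<open>3\<close>, hence at least
      \<open>exp 1\<close>; this keeps the factor \<open>ln - 1\<close> nonnegative and the product
      monotone.\<close>
    have low: "(real n - 1) / 2 * (ln ((real n - 1) / 2) - 1) \<le> ln (real (min_speed n))" if "n \<ge> 8" for n
    proof -
      have "n \<le> 2 * (n div 2) + 1" by simp
      then have "real n \<le> real (2 * (n div 2) + 1)" by (rule of_nat_mono)
      then have m: "(real n - 1) / 2 \<le> real (n div 2)" by simp
      have "1 \<le> ln ((real n - 1) / 2)"
      proof -
        have "exp 1 \<le> (3::real)" by (rule exp_le)
        also have "\<dots> \<le> (real n - 1) / 2" using that by simp
        finally have "exp 1 \<le> (real n - 1) / 2" .
        then show ?thesis using that by (subst ln_ge_iff) auto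
      qed
      moreover have "ln ((real n - 1) / 2) \<le> ln (real (n div 2))"
        using m that by (subst ln_le_cancel_iff) auto
      ultimately have "(real n - 1) / 2 * (ln ((real n - 1) / 2) - 1) \<le> real (n div 2) * (ln (real (n div 2)) - 1)"
        using m by (intro mult_mono) auto
      also have "\<dots> \<le> ln (fact (n div 2))" by (rule ln_fact_ge)
      also have "\<dots> \<le> ln (real (min_speed n))"
        using of_nat_mono[OF fact_le_min_speed[of n], where 'a = real] pos[of n] by simp
      finally show ?thesis .
    qed
    let ?l = "\<lambda>n. ((real n - 1) / 2 * (ln ((real n - 1) / 2) - 1) / ln (real n) - real n / 2) / real n"
    let ?u = "\<lambda>n. ((real n * ln 2 + real n / 2 * ln (real n)) / ln (real n) - real n / 2) / real n"
    show "(\<lambda>n. \<epsilon> n / real n) \<longlonglongrightarrow> 0"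
    proof (rule tendsto_sandwich)
      show "?l \<longlonglongrightarrow> 0" by real_asymp
      show "?u \<longlonglongrightarrow> 0" by real_asymp
      show "\<forall>\<^sub>F n in sequentially. ?l n \<le> \<epsilon> n / real n"
        using eventually_ge_at_top[of 8] unfolding \<epsilon>_def
        by eventually_elim (intro divide_right_mono diff_right_mono low; simp)
      show "\<forall>\<^sub>F n in sequentially. \<epsilon> n / real n \<le> ?u n"
        using eventually_ge_at_top[of 8] unfolding \<epsilon>_def
        by eventually_elim (intro divide_right_mono diff_right_mono up; simp)
    qed
    show "\<forall>\<^sub>F n in sequentially. real n \<noteq> 0"
      using eventually_gt_at_top[of 0] by eventually_elim auto
  qed
  ultimately show ?thesis by blast
qed

section \<open>Minimality and uniqueness\<close>

lemma crossing_property_subset_parts_le_2: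
  assumes "crossing_property \<subseteq> \<P>"
  shows "crossing_property \<subseteq> parts_le_2 \<P>"
proof
  fix P assume P: "P \<in> crossing_property"
  then obtain n where n: "partition_on {1..n} P" "crossing P" by (auto simp: crossing_property_def)
  obtain \<pi> where "P = (\<lambda>x. {x, \<pi> x}) ` {1..n}" using crossing_involution[OF n] by metis
  moreover have "card {x, \<pi> x} \<le> 2" for x by (cases "\<pi> x = x") auto
  ultimately show "P \<in> parts_le_2 \<P>" using P assms by (auto simp: parts_le_2_def)
qed

lemma speed_mono: "\<P> \<subseteq> \<Q> \<Longrightarrow> speed \<P> n \<le> speed \<Q> n"
  unfolding speed_def by (intro card_mono finite_level) (auto simp: level_def)

text \<open>The speed forces \<open>\<Q>\<close> to contain all crossing partitions. Each level is
  finite and has the same cardinality on both sides, so the inclusion is an equality level by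
  level.\<close>

lemma crossing_property_unique:
  assumes her: "hereditary \<Q>" and speed: "\<And>n. speed \<Q> n = min_speed n"
  shows "\<Q> = crossing_property"
proof
  show sub: "crossing_property \<subseteq> \<Q>"
    using her perm_partition_if_superexponential[OF her superexponential_if_speed_eq[OF speed]]
    by (intro crossing_property_subset)
  show "\<Q> \<subseteq> crossing_property"
  proof
    fix P assume P: "P \<in> \<Q>"
    then obtain n where n: "partition_on {1..n} P"
      using her unfolding hereditary_def partition_property_def by blast
    have "level crossing_property n = level \<Q> n"
    proof (rule card_subset_eq)
      show "level crossing_property n \<subseteq> level \<Q> n" using sub by (auto simp: level_def)
      show "card (level crossing_property n) = card (level \<Q> n)"
        using speed speed_crossing_property unfolding speed_def by simp
    qed (rule finite_level)
    then show "P \<in> crossing_property" using P n by (auto simp: level_def)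
  qed
qed

theorem theorem3:
  shows "(\<forall>\<P>. hereditary \<P> \<and> superexponential \<P> \<longrightarrow>
            (\<forall>k \<pi>. \<pi> permutes {1..k} \<longrightarrow> perm_partition k \<pi> \<in> \<P>) \<and>
            (\<forall>n. speed \<P> n \<ge> speed (parts_le_2 \<P>) n \<and> speed (parts_le_2 \<P>) n \<ge> min_speed n))
       \<and> (\<exists>\<epsilon>::nat \<Rightarrow> real. \<epsilon> \<in> o(\<lambda>n. real n) \<and>
            (\<forall>n\<ge>1. real (min_speed n) = real n powr (real n / 2 + \<epsilon> n)))
       \<and> (\<exists>\<Q>. hereditary \<Q> \<and> superexponential \<Q> \<and> (\<forall>n. speed \<Q> n = min_speed n))
       \<and> (\<exists>!\<Q>. hereditary \<Q> \<and> (\<forall>n. speed \<Q> n = min_speed n))"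
proof (intro conjI allI impI)
  fix \<P> assume \<P>: "hereditary \<P> \<and> superexponential \<P>"
  then show H: "perm_partition k \<pi> \<in> \<P>" if "\<pi> permutes {1..k}" for k \<pi>
    using perm_partition_if_superexponential that by blast
  show "speed (parts_le_2 \<P>) n \<le> speed \<P> n" for n
    by (rule speed_mono) (auto simp: parts_le_2_def)
  have "crossing_property \<subseteq> parts_le_2 \<P>"
    using \<P> H by (intro crossing_property_subset_parts_le_2 crossing_property_subset) auto
  then show "min_speed n \<le> speed (parts_le_2 \<P>) n" for n
    using speed_mono speed_crossing_property by metis
next
  show "\<exists>\<epsilon>::nat \<Rightarrow> real. \<epsilon> \<in> o(\<lambda>n. real n) \<and>
      (\<forall>n\<ge>1. real (min_speed n) = real n powr (real n / 2 + \<epsilon> n))"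
    by (rule min_speed_asymp)
  \<comment> \<open>The bound is attained by a property that itself satisfies the hypotheses of the
    lower bound, which is the sense of best possible.\<close>
  show "\<exists>\<Q>. hereditary \<Q> \<and> superexponential \<Q> \<and> (\<forall>n. speed \<Q> n = min_speed n)"
    using hereditary_crossing_property superexponential_if_speed_eq speed_crossing_property by blast
  show "\<exists>!\<Q>. hereditary \<Q> \<and> (\<forall>n. speed \<Q> n = min_speed n)"
    using hereditary_crossing_property speed_crossing_property crossing_property_unique by blast
qed

end
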